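(* Let $W$ be the $(2,1)$-additive Brownian sheet and let $G(W)\subset\mathbb{R}^3$ be its graph. Then, almost surely, the Fourier dimension of $G(W)$ is $$\dim_{\mathrm{F}}G(W)=2.$$
   Context: The $(2,1)$-additive Brownian sheet is the random map $W:[0,1]^2\to\mathbb{R}$ given by $W(t_1,t_2)=W^1(t_1)+W^2(t_2)$, where $W^1,W^2:[0,1]\to\mathbb{R}$ are independent standard one-parameter Brownian motions (almost surely continuous, $W^i(0)=0$). Its graph is $G(W)=\{(t,W(t)):t\in[0,1]^2\}$. For a Borel set $X\subset\mathbb{R}^d$, the Fourier dimension is $$\dim_{\mathrm{F}}X=\sup\Big\{s\in[0,d]:\text{there exists a nonzero finite Borel measure }\mu\text{ supported on }X\text{ with }\sup_{\xi\in\mathbb{R}^d}|\widehat{\mu}(\xi)|^2|\xi|^s<\infty\Big\},$$ where $\widehat{\mu}(\xi)=\int e^{-2\pi i\xi\cdot x}\,d\mu(x)$. *)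

theory Defs
  imports "HOL-Probability.Probability"
begin

text \<open>Only the values at times in \<open>[0,1]\<close> are constrained. The second argument of
  \<^const>\<open>normal_density\<close> is the standard deviation, so the increment over \<open>[s,t]\<close>
  has variance \<open>t - s\<close>.\<close>

locale standard_brownian_motion = prob_space M
  for M :: "'w measure" and B :: "real \<Rightarrow> 'w \<Rightarrow> real" +
  assumes measurable_B: "\<And>t. t \<in> {0..1} \<Longrightarrow> B t \<in> borel_measurable M"
    and start_zero: "AE \<omega> in M. B 0 \<omega> = 0"
    and normal_increments: "\<And>s t. 0 \<le> s \<Longrightarrow> s < t \<Longrightarrow> t \<le> 1 \<Longrightarrow>
      distributed M lborel (\<lambda>\<omega>. B t \<omega> - B s \<omega>) (normal_density 0 (sqrt (t - s)))"
    and indep_increments: "\<And>(n::nat) t. t ` {..n} \<subseteq> {0..1} \<Longrightarrow> strict_mono_on {..n} t \<Longrightarrow>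
      indep_vars (\<lambda>_. borel) (\<lambda>i \<omega>. B (t (Suc i)) \<omega> - B (t i) \<omega>) {..<n}"
    and continuous_paths: "AE \<omega> in M. continuous_on {0..1} (\<lambda>t. B t \<omega>)"

text \<open>Independence of the two motions is independence of the whole processes, each viewed as a
  random element of the product measurable space \<open>\<real>\<close>-to-the-\<open>[0,1]\<close>.\<close>

definition additive_brownian_sheet_2_1 :: "'w measure \<Rightarrow> (real \<times> real \<Rightarrow> 'w \<Rightarrow> real) \<Rightarrow> bool" where
  "additive_brownian_sheet_2_1 M W \<longleftrightarrow>
    (\<exists>W1 W2. standard_brownian_motion M W1 \<and> standard_brownian_motion M W2 \<and>
      prob_space.indep_var M
        (\<Pi>\<^sub>M t\<in>{0..1}. borel) (\<lambda>\<omega>. \<lambda>t\<in>{0..1}. W1 t \<omega>)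
        (\<Pi>\<^sub>M t\<in>{0..1}. borel) (\<lambda>\<omega>. \<lambda>t\<in>{0..1}. W2 t \<omega>) \<and>
      (\<forall>t1\<in>{0..1}. \<forall>t2\<in>{0..1}. \<forall>\<omega>\<in>space M. W (t1, t2) \<omega> = W1 t1 \<omega> + W2 t2 \<omega>))"

text \<open>The type \<open>(real \<times> real) \<times> real\<close> carries the Euclidean norm and inner product, so it serves as
  three-dimensional Euclidean space.\<close>

definition sheet_graph :: "(real \<times> real \<Rightarrow> 'w \<Rightarrow> real) \<Rightarrow> 'w \<Rightarrow> ((real \<times> real) \<times> real) set" where
  "sheet_graph W \<omega> = {(t, W t \<omega>) | t. t \<in> {0..1} \<times> {0..1}}"

definition fourier_transform :: "'a::euclidean_space measure \<Rightarrow> 'a \<Rightarrow> complex" where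
  "fourier_transform \<mu> \<xi> = (LINT x|\<mu>. exp (- 2 * of_real pi * \<i> * of_real (\<xi> \<bullet> x)))"

text \<open>For Borel \<open>X\<close>, the condition that almost every point lies in \<open>X\<close> says that the complement of
  \<open>X\<close> has measure zero. For nonempty \<open>X\<close> the set of admissible exponents contains \<open>0\<close>
  (take a Dirac measure), so the supremum is proper; nothing is intended for \<open>X = {}\<close>.
  The Isabelle convention \<open>0 powr 0 = 0\<close> only affects the single value at \<open>\<xi> = 0\<close>, hence not
  the boundedness.\<close>

definition fourier_dimension :: "'a::euclidean_space set \<Rightarrow> real" where
  "fourier_dimension X = Sup {s \<in> {0..real DIM('a)}.
     \<exists>\<mu> :: 'a measure. sets \<mu> = sets borel \<and> finite_measure \<mu> \<and> emeasure \<mu> UNIV \<noteq> 0 \<and>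
       (AE x in \<mu>. x \<in> X) \<and>
       bdd_above (range (\<lambda>\<xi>. (cmod (fourier_transform \<mu> \<xi>))\<^sup>2 * norm \<xi> powr s))}"

end

theory Submission
  imports Defs "HOL-Real_Asymp.Real_Asymp"
begin

text \<open>Upper bound, for the graph of any continuous \<open>f\<close> on the square: integrate \<open>|\<integral> exp (\<i> \<xi> \<bullet> x) d\<mu>(x)|\<^sup>2\<close> of a measure
  \<open>\<mu>\<close> on the graph against a Gaussian with standard deviations \<open>N, N, Z\<close>. This is the energy of \<open>\<mu>\<close> for
  a Gaussian kernel of widths \<open>1/N, 1/N, 1/Z\<close>. If \<open>f\<close> oscillates by less than \<open>1/Z\<close> on squares of side
  \<open>1/N\<close>, the diagonal cells alone contribute at least a constant times \<open>N\<^sup>-\<^sup>2\<close>, whereas Fourier decay with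
  exponent \<open>s > 2\<close> bounds the integral by \<open>o(1) N\<^sup>-\<^sup>2\<close> as \<open>Z \<rightarrow> \<infinity>\<close>.

  Lower bound: the Fourier transform of the push-forward of Lebesgue measure on the square is a product of
  two integrals \<open>F(a, z) = \<integral>\<^sub>0\<^sup>1 exp (\<i> (a t + z B\<^sub>t)) dt\<close>. By Ito's formula \<open>(z\<^sup>2/2 - \<i> a) F(a, z)\<close> is a bounded
  term plus \<open>\<i> z\<close> times a stochastic integral of a unimodular process; a discrete version of this identity
  gives exponential moments, hence almost surely
  \<open>|F(a, z)| \<le> C (1 + |z|) (1 + log (3 + |a| + |z|)) / (1 + z\<^sup>2 + |a|)\<close> for all \<open>a, z\<close>.
  The product of two such bounds with a common \<open>z\<close> decays like \<open>|\<xi>|\<^sup>-\<^sup>1\<close> up to logarithms.\<close>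

section \<open>Gaussian averages\<close>

text \<open>The exponents of interest take both signs, so the familiar bound on the unit interval
  does not suffice. For u = -v < 0 the Taylor bound exp v \<ge> 1 + v + v^2/2 is enough, because (1
  - v + v^2)(1 + v + v^2/2) exceeds 1 by (v^2 + v^3 + v^4)/2.\<close>

lemma exp_le_quadratic:
  fixes u :: real
  assumes "u \<le> 1"
  shows "exp u \<le> 1 + u + u\<^sup>2"
proof (cases "u \<ge> 0")
  case True
  then show ?thesis using assms by (rule exp_bound)
next
  case False
  define v where "v = - u"
  have v: "v \<ge> 0" using False by (simp add: v_def)
  have "1 \<le> 1 + (v\<^sup>2 + v^3 + v^4) / 2" using v by simp
  also have "\<dots> = (1 - v + v\<^sup>2) * (1 + v + v\<^sup>2 / 2)"
    by (simp add: field_simps eval_nat_numeral)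
  also have "\<dots> \<le> (1 - v + v\<^sup>2) * exp v"
  proof (rule mult_left_mono)
    have "0 \<le> (v - 1/2)\<^sup>2 + 3/4" by simp
    also have "\<dots> = 1 - v + v\<^sup>2" by (simp add: power2_eq_square algebra_simps)
    finally show "0 \<le> 1 - v + v\<^sup>2" .
  qed (use exp_lower_Taylor_quadratic[OF v] in simp)
  finally show ?thesis by (simp add: v_def exp_minus field_simps)
qed

lemma distr_std_normal_scale:
  assumes "\<sigma> > 0"
  shows "distr std_normal_distribution borel (\<lambda>x. \<sigma> * x) = density lborel (normal_density 0 \<sigma>)"
proof -
  interpret N: prob_space std_normal_distribution by (rule prob_space_normal_density) simp
  have "distributed std_normal_distribution lborel (\<lambda>x. x) (normal_density 0 1)"
    unfolding distributed_def by (auto simp: distr_id2)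
  from N.normal_density_affine[OF this, of \<sigma> 0] assms
  have "distributed std_normal_distribution lborel (\<lambda>x. \<sigma> * x) (normal_density 0 \<sigma>)" by simp
  then have "distr std_normal_distribution lborel (\<lambda>x. \<sigma> * x) = density lborel (normal_density 0 \<sigma>)"
    by (rule distributed_distr_eq_density)
  then show ?thesis by (simp cong: distr_cong)
qed

lemma integral_cis_normal:
  assumes "\<sigma> > 0"
  shows "(LINT x|density lborel (normal_density 0 \<sigma>). cis (z * x)) = of_real (exp (- (z * \<sigma>)\<^sup>2 / 2))"
proof -
  have "(LINT x|density lborel (normal_density 0 \<sigma>). cis (z * x)) =
      (LINT x|std_normal_distribution. cis (z * (\<sigma> * x)))"
    unfolding distr_std_normal_scale[OF assms, symmetric]
    by (subst integral_distr) (auto intro!: borel_measurable_continuous_onI continuous_intros)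
  also have "\<dots> = char std_normal_distribution (z * \<sigma>)"
    unfolding char_def by (simp add: cis_conv_exp mult_ac)
  finally show ?thesis by (simp add: char_std_normal_distribution)
qed

section \<open>Product integrals and the energy of a measure\<close>

lemma integral_pair_mult:
  fixes f :: "'a \<Rightarrow> complex" and g :: "'b \<Rightarrow> complex"
  assumes M: "sigma_finite_measure M" and N: "sigma_finite_measure N"
    and f: "integrable M f" and g: "integrable N g"
  shows "integral\<^sup>L (M \<Otimes>\<^sub>M N) (\<lambda>p. f (fst p) * g (snd p)) = integral\<^sup>L M f * integral\<^sup>L N g"
proof -
  interpret M: sigma_finite_measure M by fact
  interpret N: sigma_finite_measure N by fact
  interpret pair_sigma_finite M N ..
  have [measurable]: "f \<in> borel_measurable M" "g \<in> borel_measurable N" using f g by auto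
  have "integrable (M \<Otimes>\<^sub>M N) (\<lambda>p. f (fst p) * g (snd p))"
    by (rule Fubini_integrable) (use f g in \<open>auto simp: norm_mult\<close>)
  then have "integral\<^sup>L (M \<Otimes>\<^sub>M N) (\<lambda>p. f (fst p) * g (snd p)) = (\<integral>x. (\<integral>y. f x * g y \<partial>N) \<partial>M)"
    using integral_fst'[of "\<lambda>p. f (fst p) * g (snd p)"] by simp
  also have "\<dots> = (\<integral>x. f x * integral\<^sup>L N g \<partial>M)" by simp
  finally show ?thesis by simp
qed

lemma nn_integral_pair_mult:
  assumes "sigma_finite_measure N"
    and [measurable]: "f \<in> borel_measurable M" "g \<in> borel_measurable N"
  shows "integral\<^sup>N (M \<Otimes>\<^sub>M N) (\<lambda>p. f (fst p) * g (snd p)) = integral\<^sup>N M f * integral\<^sup>N N g"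
proof -
  interpret N: sigma_finite_measure N by fact
  have "integral\<^sup>N (M \<Otimes>\<^sub>M N) (\<lambda>p. f (fst p) * g (snd p)) = (\<integral>\<^sup>+x. (\<integral>\<^sup>+y. f x * g y \<partial>N) \<partial>M)"
    by (subst N.nn_integral_fst[symmetric]) auto
  also have "\<dots> = (\<integral>\<^sup>+x. f x * integral\<^sup>N N g \<partial>M)" by (simp add: nn_integral_cmult)
  finally show ?thesis by (simp add: nn_integral_multc)
qed

lemma sets_pair_borel:
  fixes M :: "'a::second_countable_topology measure" and N :: "'b::second_countable_topology measure"
  assumes "sets M = sets borel" "sets N = sets borel"
  shows "sets (M \<Otimes>\<^sub>M N) = sets borel"
  unfolding borel_prod[symmetric] using assms by (rule sets_pair_measure_cong)

lemma measurable_cis_inner [measurable]: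
  fixes f g :: "'c \<Rightarrow> 'a::euclidean_space"
  assumes [measurable]: "f \<in> borel_measurable M" "g \<in> borel_measurable M"
  shows "(\<lambda>x. cis (f x \<bullet> g x)) \<in> borel_measurable M"
proof -
  have [measurable]: "cis \<in> borel_measurable borel"
    by (auto intro!: borel_measurable_continuous_onI continuous_intros)
  show ?thesis by measurable
qed

text \<open>The squared modulus is a double integral of cis(\<xi> . (x - y)), and Fubini moves the
  \<xi>-integral inside. A mean square of the Fourier transform thus becomes the energy of
  \<open>\<mu>\<close> for the kernel given by the Fourier transform of
  \<open>\<nu>\<close>.\<close>

lemma integral_cmod_sq_char:
  fixes \<mu> \<nu> :: "'a::euclidean_space measure"
  assumes mu: "finite_measure \<mu>" "sets \<mu> = sets borel" and nu: "finite_measure \<nu>" "sets \<nu> = sets borel"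
  shows "of_real (LINT \<xi>|\<nu>. (cmod (LINT x|\<mu>. cis (\<xi> \<bullet> x)))\<^sup>2) =
    (LINT p|(\<mu> \<Otimes>\<^sub>M \<mu>). LINT \<xi>|\<nu>. cis (\<xi> \<bullet> (fst p - snd p)))"
proof -
  interpret mu: finite_measure \<mu> by fact
  interpret nu: finite_measure \<nu> by fact
  interpret mm: pair_sigma_finite \<mu> \<mu> ..
  interpret P: finite_measure "\<mu> \<Otimes>\<^sub>M \<mu>" by (rule finite_measure_pair_measure) fact+
  interpret Q: pair_sigma_finite \<nu> "\<mu> \<Otimes>\<^sub>M \<mu>" ..
  interpret Q': finite_measure "\<nu> \<Otimes>\<^sub>M (\<mu> \<Otimes>\<^sub>M \<mu>)"
    by (intro finite_measure_pair_measure mu nu)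
  note [measurable_cong] = mu(2) nu(2)
  have int: "integrable \<mu> (\<lambda>x. cis (\<xi> \<bullet> x))" for \<xi>
    by (rule mu.integrable_const_bound[of _ 1]) auto
  have sq: "of_real ((cmod (LINT x|\<mu>. cis (\<xi> \<bullet> x)))\<^sup>2) = (LINT p|(\<mu> \<Otimes>\<^sub>M \<mu>). cis (\<xi> \<bullet> (fst p - snd p)))" for \<xi>
  proof -
    have "of_real ((cmod (LINT x|\<mu>. cis (\<xi> \<bullet> x)))\<^sup>2) = (LINT x|\<mu>. cis (\<xi> \<bullet> x)) * cnj (LINT x|\<mu>. cis (\<xi> \<bullet> x))"
      by (rule complex_norm_square)
    also have "\<dots> = (LINT x|\<mu>. cis (\<xi> \<bullet> x)) * (LINT x|\<mu>. cnj (cis (\<xi> \<bullet> x)))" by simp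
    also have "\<dots> = (LINT p|(\<mu> \<Otimes>\<^sub>M \<mu>). cis (\<xi> \<bullet> fst p) * cnj (cis (\<xi> \<bullet> snd p)))"
      using int by (intro integral_pair_mult[symmetric] mu.sigma_finite_measure_axioms) auto
    also have "(\<lambda>p. cis (\<xi> \<bullet> fst p) * cnj (cis (\<xi> \<bullet> snd p))) = (\<lambda>p. cis (\<xi> \<bullet> (fst p - snd p)))"
      by (simp add: cis_cnj cis_mult inner_diff_right)
    finally show ?thesis .
  qed
  have "of_real (LINT \<xi>|\<nu>. (cmod (LINT x|\<mu>. cis (\<xi> \<bullet> x)))\<^sup>2) = (LINT \<xi>|\<nu>. LINT p|(\<mu> \<Otimes>\<^sub>M \<mu>). cis (\<xi> \<bullet> (fst p - snd p)))"
    unfolding sq[symmetric] by (rule integral_complex_of_real[symmetric])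
  also have "\<dots> = (LINT p|(\<mu> \<Otimes>\<^sub>M \<mu>). LINT \<xi>|\<nu>. cis (\<xi> \<bullet> (fst p - snd p)))"
    by (rule Q.Fubini_integral[symmetric], rule Q'.integrable_const_bound[of _ 1]) (auto simp: split_beta)
  finally show ?thesis .
qed

text \<open>Cauchy-Schwarz over the cells bounds the squared total mass by \<open>card I\<close>
  times the sum of the squared cell masses. That sum is the product measure of the diagonal blocks,
  where the kernel is at least \<open>\<kappa>\<close>.\<close>

lemma square_measure_le_card_times_energy:
  fixes \<mu> :: "'a measure" and A :: "'i \<Rightarrow> 'a set"
  assumes "finite_measure \<mu>" and I: "finite I" and A: "\<And>i. i \<in> I \<Longrightarrow> A i \<in> sets \<mu>" "disjoint_family_on A I"
    and full: "AE x in \<mu>. x \<in> (\<Union>i\<in>I. A i)"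
    and k: "integrable (\<mu> \<Otimes>\<^sub>M \<mu>) k" "\<And>p. k p \<ge> 0"
    and diag: "\<And>i x y. i \<in> I \<Longrightarrow> x \<in> A i \<Longrightarrow> y \<in> A i \<Longrightarrow> k (x, y) \<ge> \<kappa>" and "\<kappa> \<ge> 0"
  shows "\<kappa> * (measure \<mu> (space \<mu>))\<^sup>2 \<le> card I * (LINT p|(\<mu> \<Otimes>\<^sub>M \<mu>). k p)"
proof -
  interpret mu: finite_measure \<mu> by fact
  interpret P: finite_measure "\<mu> \<Otimes>\<^sub>M \<mu>" by (rule finite_measure_pair_measure) fact+
  have AA: "A i \<times> A i \<in> sets (\<mu> \<Otimes>\<^sub>M \<mu>)" if "i \<in> I" for i using A that by auto
  have mAA: "measure (\<mu> \<Otimes>\<^sub>M \<mu>) (A i \<times> A i) = (measure \<mu> (A i))\<^sup>2" if "i \<in> I" for i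
    using A(1)[OF that] by (simp add: measure_def mu.emeasure_pair_measure_Times enn2real_mult power2_eq_square)
  have "measure \<mu> (space \<mu>) = measure \<mu> (\<Union>i\<in>I. A i)"
    using full A I by (intro mu.finite_measure_eq_AE) auto
  also have "\<dots> = (\<Sum>i\<in>I. measure \<mu> (A i))"
    using A I by (intro mu.finite_measure_finite_Union) auto
  finally have "(measure \<mu> (space \<mu>))\<^sup>2 \<le> card I * (\<Sum>i\<in>I. (measure \<mu> (A i))\<^sup>2)"
    using sum_squared_le_sum_of_squares[of "\<lambda>i. measure \<mu> (A i)" I] by (simp add: mult.commute)
  then have "\<kappa> * (measure \<mu> (space \<mu>))\<^sup>2 \<le> \<kappa> * (card I * (\<Sum>i\<in>I. (measure \<mu> (A i))\<^sup>2))"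
    using \<open>\<kappa> \<ge> 0\<close> by (rule mult_left_mono)
  also have "\<dots> = card I * (\<Sum>i\<in>I. \<kappa> * measure (\<mu> \<Otimes>\<^sub>M \<mu>) (A i \<times> A i))"
    by (simp add: mAA sum_distrib_left mult_ac)
  also have "(\<Sum>i\<in>I. \<kappa> * measure (\<mu> \<Otimes>\<^sub>M \<mu>) (A i \<times> A i)) = (LINT p|(\<mu> \<Otimes>\<^sub>M \<mu>). (\<Sum>i\<in>I. \<kappa> * indicator (A i \<times> A i) p))"
    using AA by (subst Bochner_Integration.integral_sum) (auto simp: less_top[symmetric])
  also have "\<dots> \<le> (LINT p|(\<mu> \<Otimes>\<^sub>M \<mu>). k p)"
  proof (intro integral_mono k)
    show "integrable (\<mu> \<Otimes>\<^sub>M \<mu>) (\<lambda>p. \<Sum>i\<in>I. \<kappa> * indicator (A i \<times> A i) p)"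
      using AA by (intro Bochner_Integration.integrable_sum integrable_mult_right) (auto simp: less_top[symmetric])
    fix p :: "'a \<times> 'a"
    \<comment> \<open>The diagonal blocks are disjoint, so at most one summand is nonzero at
      \<open>p\<close>.\<close>
    show "(\<Sum>i\<in>I. \<kappa> * indicator (A i \<times> A i) p) \<le> k p"
    proof (cases "\<exists>i\<in>I. p \<in> A i \<times> A i")
      case True
      then obtain i where i: "i \<in> I" "p \<in> A i \<times> A i" by blast
      have "indicator (A j \<times> A j) p = (if j = i then 1 else 0 :: real)" if "j \<in> I" for j
        using i that A(2) by (auto simp: disjoint_family_on_def indicator_def)
      then have "(\<Sum>j\<in>I. \<kappa> * indicator (A j \<times> A j) p) = (\<Sum>j\<in>I. if j = i then \<kappa> else 0)"
        by (intro sum.cong) auto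
      also have "\<dots> = \<kappa>" using i I by simp
      also have "\<dots> \<le> k p" using diag[of i "fst p" "snd p"] i by auto
      finally show ?thesis .
    next
      case False
      then have "(\<Sum>i\<in>I. \<kappa> * indicator (A i \<times> A i) p) = 0" by (intro sum.neutral) (auto simp: indicator_def)
      then show ?thesis using k(2)[of p] by simp
    qed
  qed
  finally show ?thesis by (simp add: mult_left_mono)
qed

text \<open>A weight on the frequency side: \<open>\<sigma>\<close> belongs to the two time
  frequencies and \<open>\<tau>\<close> to the value frequency. The scales are separate because the
  resolution in time must follow the modulus of continuity of the function once the resolution in
  value is fixed.\<close>

definition gauss3 :: "real \<Rightarrow> real \<Rightarrow> ((real \<times> real) \<times> real) measure" where
  "gauss3 \<sigma> \<tau> = (density lborel (normal_density 0 \<sigma>) \<Otimes>\<^sub>M density lborel (normal_density 0 \<sigma>))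
     \<Otimes>\<^sub>M density lborel (normal_density 0 \<tau>)"

lemma sets_gauss3: "sets (gauss3 \<sigma> \<tau>) = sets borel"
  unfolding gauss3_def by (intro sets_pair_borel) auto

lemma finite_measure_gauss3:
  assumes "\<sigma> > 0" "\<tau> > 0"
  shows "finite_measure (gauss3 \<sigma> \<tau>)"
  unfolding gauss3_def
  by (intro finite_measure_pair_measure prob_space.finite_measure prob_space_normal_density assms)

lemma integral_cis_gauss3:
  assumes "\<sigma> > 0" "\<tau> > 0"
  shows "(LINT \<xi>|gauss3 \<sigma> \<tau>. cis (\<xi> \<bullet> x)) =
    of_real (exp (- ((fst (fst x) * \<sigma>)\<^sup>2 + (snd (fst x) * \<sigma>)\<^sup>2 + (snd x * \<tau>)\<^sup>2) / 2))"
proof -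
  define N where "N \<sigma> = density lborel (normal_density 0 \<sigma>)" for \<sigma>
  have N: "prob_space (N s)" "finite_measure (N s)" "sigma_finite_measure (N s)" if "s > 0" for s
    using prob_space_normal_density[OF that, of 0]
    by (simp_all add: N_def prob_space.finite_measure finite_measure.axioms(1) prob_space_def)
  have [measurable]: "cis \<in> borel_measurable borel"
    by (auto intro!: borel_measurable_continuous_onI continuous_intros)
  have ci: "integrable (N s) (\<lambda>y. cis (t * y))" if "s > 0" for s t
    by (rule finite_measure.integrable_const_bound[OF N(2)[OF that], of _ 1]) (auto simp: N_def)
  have fin2: "finite_measure (N \<sigma> \<Otimes>\<^sub>M N \<sigma>)" using assms by (intro finite_measure_pair_measure N)
  define f where "f p = cis (fst (fst x) * fst p) * cis (snd (fst x) * snd p)" for p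
  have "integrable (N \<sigma> \<Otimes>\<^sub>M N \<sigma>) f"
    unfolding f_def
    by (rule finite_measure.integrable_const_bound[OF fin2, of _ 1]) (auto simp: N_def norm_mult)
  have "(LINT \<xi>|gauss3 \<sigma> \<tau>. cis (\<xi> \<bullet> x)) = (LINT \<xi>|((N \<sigma> \<Otimes>\<^sub>M N \<sigma>) \<Otimes>\<^sub>M N \<tau>). f (fst \<xi>) * cis (snd x * snd \<xi>))"
    unfolding gauss3_def N_def f_def
    by (intro Bochner_Integration.integral_cong) (auto simp: inner_prod_def cis_mult algebra_simps)
  also have "\<dots> = (LINT \<xi>|(N \<sigma> \<Otimes>\<^sub>M N \<sigma>). f \<xi>) * (LINT \<xi>|N \<tau>. cis (snd x * \<xi>))"
    using assms by (intro integral_pair_mult ci N \<open>integrable _ f\<close> finite_measure.axioms(1)[OF fin2])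
  also have "(LINT \<xi>|(N \<sigma> \<Otimes>\<^sub>M N \<sigma>). f \<xi>) = (LINT \<xi>|N \<sigma>. cis (fst (fst x) * \<xi>)) * (LINT \<xi>|N \<sigma>. cis (snd (fst x) * \<xi>))"
    unfolding f_def using assms by (intro integral_pair_mult ci N)
  finally show ?thesis
    using assms by (simp add: N_def integral_cis_normal exp_add[symmetric] of_real_mult[symmetric] add_divide_distrib
      del: of_real_mult of_real_exp)
qed

text \<open>The Gaussian density is at most 1/\<sigma> everywhere, and the weight has total integral
  2/a since its exponent exceeds 1. Each time frequency will contribute one such factor
  1/\<sigma>.\<close>

lemma nn_integral_powr_normal_le:
  assumes "a > 0"
  obtains K where "K \<ge> 0"
    "\<And>\<sigma>. \<sigma> > 0 \<Longrightarrow> (\<integral>\<^sup>+x. ennreal ((1 + \<bar>x\<bar>) powr (-(1 + a))) \<partial>density lborel (normal_density 0 \<sigma>)) \<le> ennreal (K / \<sigma>)"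
proof -
  define h where "h x = (1 + \<bar>x\<bar>) powr (-(1 + a))" for x :: real
  have [measurable]: "h \<in> borel_measurable borel" unfolding h_def by measurable
  have half: "(\<integral>\<^sup>+x. ennreal (h x) * indicator {0..} x \<partial>lborel) = ennreal (1 / a)"
  proof -
    have "(\<integral>\<^sup>+x. ennreal (h x) * indicator {0..} x \<partial>lborel)
        = (\<integral>\<^sup>+x. ennreal ((1 + x) powr (-(1 + a))) * indicator {0..} x \<partial>lborel)"
      by (intro nn_integral_cong) (auto simp: h_def indicator_def)
    also have "\<dots> = ennreal (0 - (- ((1 + 0) powr (- a)) / a))"
    proof (rule nn_integral_FTC_atLeast)
      fix x :: real assume "x \<ge> 0"
      then show "DERIV (\<lambda>x. - ((1 + x) powr (- a)) / a) x :> (1 + x) powr (-(1 + a))"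
        using assms DERIV_cdivide[OF DERIV_minus[OF DERIV_fun_powr[of "\<lambda>x. 1 + x" 1 x "- a"]], of a]
        by (auto intro!: derivative_eq_intros simp: minus_diff_commute add.commute)
    next
      have "((\<lambda>x. (1 + x) powr (- a)) \<longlongrightarrow> 0) at_top"
        using assms by real_asymp
      then show "((\<lambda>x. - ((1 + x) powr (- a)) / a) \<longlongrightarrow> 0) at_top"
        using tendsto_divide[OF tendsto_minus tendsto_const] assms by fastforce
    qed auto
    finally show ?thesis by simp
  qed
  have "(\<integral>\<^sup>+x. ennreal (h x) * indicator {..0} x \<partial>lborel) = (\<integral>\<^sup>+x. ennreal (h x) * indicator {0..} x \<partial>lborel)"
    by (subst nn_integral_real_affine[where c = "-1" and t = 0]) (auto intro!: nn_integral_cong simp: h_def indicator_def)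
  moreover have "(\<integral>\<^sup>+x. ennreal (h x) \<partial>lborel) \<le> (\<integral>\<^sup>+x. ennreal (h x) * indicator {..0} x + ennreal (h x) * indicator {0..} x \<partial>lborel)"
    by (intro nn_integral_mono) (auto simp: indicator_def)
  ultimately have tot: "(\<integral>\<^sup>+x. ennreal (h x) \<partial>lborel) \<le> ennreal (2 / a)"
    using assms by (simp add: nn_integral_add half ennreal_plus[symmetric] del: ennreal_plus)
  show thesis
  proof (rule that[of "2 / a"])
    fix \<sigma> :: real assume s: "\<sigma> > 0"
    have nd: "normal_density 0 \<sigma> x \<le> 1 / \<sigma>" for x
    proof -
      have "sqrt (2 * pi * \<sigma>\<^sup>2) \<ge> sqrt (\<sigma>\<^sup>2)" using pi_ge_two by (intro real_sqrt_le_mono) (simp add: mult_le_cancel_right1)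
      then have "1 / sqrt (2 * pi * \<sigma>\<^sup>2) \<le> 1 / \<sigma>" using s by (intro divide_left_mono) auto
      then have "1 / sqrt (2 * pi * \<sigma>\<^sup>2) * exp (-(x - 0)\<^sup>2/ (2 * \<sigma>\<^sup>2)) \<le> 1 / \<sigma> * 1"
        using s by (intro mult_mono) auto
      then show ?thesis by (simp add: normal_density_def)
    qed
    have "(\<integral>\<^sup>+x. ennreal (h x) \<partial>density lborel (normal_density 0 \<sigma>)) = (\<integral>\<^sup>+x. ennreal (normal_density 0 \<sigma> x) * ennreal (h x) \<partial>lborel)"
      by (subst nn_integral_density) auto
    also have "\<dots> \<le> (\<integral>\<^sup>+x. ennreal (1 / \<sigma>) * ennreal (h x) \<partial>lborel)"
      by (intro nn_integral_mono mult_right_mono ennreal_leI nd) auto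
    also have "\<dots> \<le> ennreal (1 / \<sigma>) * ennreal (2 / a)"
      by (subst nn_integral_cmult) (auto intro!: mult_left_mono tot)
    also have "\<dots> = ennreal (2 / a / \<sigma>)" using s assms by (simp add: ennreal_mult[symmetric])
    finally show "(\<integral>\<^sup>+x. ennreal ((1 + \<bar>x\<bar>) powr (-(1 + a))) \<partial>density lborel (normal_density 0 \<sigma>)) \<le> ennreal (2 / a / \<sigma>)"
      by (simp add: h_def)
  qed (use assms in auto)
qed

text \<open>After rescaling to the standard normal law the integrand is bounded by 1 and tends to 0
  away from the null point 0, so dominated convergence applies. This is the vanishing factor in the
  upper bound for the dimension.\<close>

lemma integral_powr_normal_tendsto_0:
  assumes "a > 0"
  shows "(\<lambda>n. LINT x|density lborel (normal_density 0 (real (Suc n))). (1 + \<bar>x\<bar>) powr (- a)) \<longlonglongrightarrow> 0"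
proof -
  interpret N: prob_space std_normal_distribution by (rule prob_space_normal_density) simp
  have eq: "(LINT x|density lborel (normal_density 0 (real (Suc n))). (1 + \<bar>x\<bar>) powr (- a)) =
      (LINT x|std_normal_distribution. (1 + \<bar>real (Suc n) * x\<bar>) powr (- a))" for n
    by (subst distr_std_normal_scale[symmetric], simp, subst integral_distr) auto
  have "(\<lambda>n. LINT x|std_normal_distribution. (1 + \<bar>real (Suc n) * x\<bar>) powr (- a)) \<longlonglongrightarrow> (LINT x|std_normal_distribution. 0)"
  proof (rule integral_dominated_convergence[where w = "\<lambda>_. 1"])
    have "AE x in lborel. x \<noteq> (0::real)" by (rule AE_lborel_singleton)
    then show "AE x in std_normal_distribution. (\<lambda>n. (1 + \<bar>real (Suc n) * x\<bar>) powr (- a)) \<longlonglongrightarrow> 0"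
    proof (subst AE_density, simp, eventually_elim, intro impI)
      fix x :: real assume "x \<noteq> 0"
      then have "\<bar>x\<bar> > 0" by simp
      then have "(\<lambda>n. (1 + real (Suc n) * \<bar>x\<bar>) powr (- a)) \<longlonglongrightarrow> 0" using assms by real_asymp
      then show "(\<lambda>n. (1 + \<bar>real (Suc n) * x\<bar>) powr (- a)) \<longlonglongrightarrow> 0" by (simp add: abs_mult)
    qed
    have "(1 + \<bar>real (Suc n) * x\<bar>) powr (- a) \<le> 1" for n and x :: real
      using powr_mono[of "- a" 0 "1 + \<bar>real (Suc n) * x\<bar>"] assms by (auto split: if_splits)
    then show "AE x in std_normal_distribution. norm ((1 + \<bar>real (Suc n) * x\<bar>) powr (- a)) \<le> 1" for n
      by simp
  qed auto
  then show ?thesis unfolding eq by simp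
qed

section \<open>Fourier decay on continuous graphs\<close>

lemma norm_prod_le: "norm (x :: 'a::real_normed_vector \<times> 'b::real_normed_vector) \<le> norm (fst x) + norm (snd x)"
  using norm_Pair_le[of "fst x" "snd x"] by simp

lemma fourier_transform_conv_cis:
  "fourier_transform \<mu> \<xi> = (LINT x|\<mu>. cis (((- 2 * pi) *\<^sub>R \<xi>) \<bullet> x))"
  unfolding fourier_transform_def by (simp add: cis_conv_exp mult_ac)

lemma abs_diff_le_1_of_floor_eq:
  "\<lfloor>x\<rfloor> = \<lfloor>y\<rfloor> \<Longrightarrow> \<bar>x - y\<bar> \<le> 1" for x y :: real
  by linarith

text \<open>Uniform continuity yields \<open>N\<close>, depending on \<open>Z\<close>, such that
  \<open>f\<close> varies by less than 1/Z on squares of side 1/N. Two points of the graph over one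
  such square differ by at most 1 in each of the three rescaled coordinates, so the Gaussian kernel
  is at least exp(-3/2) there. The bound on diagonal cells then combines with the energy
  identity.\<close>

lemma graph_energy_ge:
  fixes f :: "real \<times> real \<Rightarrow> real" and \<mu> :: "((real \<times> real) \<times> real) measure"
  assumes cont: "continuous_on ({0..1} \<times> {0..1}) f"
    and mu: "finite_measure \<mu>" "sets \<mu> = sets borel"
    and graph: "AE x in \<mu>. x \<in> {(t, f t) | t. t \<in> {0..1} \<times> {0..1}}"
    and "Z > 0"
  obtains N :: nat where "N \<ge> 1"
    "exp (- 3 / 2) * (measure \<mu> UNIV)\<^sup>2 \<le> (real N + 1)\<^sup>2 *
      (LINT \<xi>|gauss3 (real N) Z. (cmod (LINT x|\<mu>. cis (\<xi> \<bullet> x)))\<^sup>2)"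
proof -
  interpret mu: finite_measure \<mu> by fact
  interpret P: finite_measure "\<mu> \<Otimes>\<^sub>M \<mu>" by (intro finite_measure_pair_measure mu)
  note [measurable_cong] = mu(2)
  let ?Q = "{0..1} \<times> {0..1} :: (real \<times> real) set"
  define G where "G = {(t, f t) | t. t \<in> ?Q}"
  have "uniformly_continuous_on ?Q f"
    by (rule compact_uniformly_continuous[OF cont]) (intro compact_Times compact_Icc)
  then obtain d where d: "d > 0"
    "\<And>x y. x \<in> ?Q \<Longrightarrow> y \<in> ?Q \<Longrightarrow> dist y x < d \<Longrightarrow> dist (f y) (f x) < 1 / Z"
    unfolding uniformly_continuous_on_def using \<open>Z > 0\<close> by (metis zero_less_divide_1_iff)
  \<comment> \<open>Half of \<open>d\<close>, because the distance of two times is estimated by the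
    sum of two coordinate differences, each at most 1/N.\<close>
  obtain N :: nat where N: "N > 0" "1 / N < d / 2"
    using d(1) by (metis inverse_eq_divide ex_inverse_of_nat_less half_gt_zero)
  have "compact ((\<lambda>t. (t, f t)) ` ?Q)"
    by (intro compact_continuous_image continuous_intros cont compact_Times compact_Icc)
  also have "(\<lambda>t. (t, f t)) ` ?Q = G" by (auto simp: G_def)
  finally have [measurable]: "G \<in> sets borel" by (intro borel_compact)
  define A where "A = (\<lambda>(i::int, j::int). {x \<in> G. \<lfloor>real N * fst (fst x)\<rfloor> = i \<and> \<lfloor>real N * snd (fst x)\<rfloor> = j})"
  \<comment> \<open>The coordinate 1 has floor index \<open>N\<close>, so there are N + 1 indices
    per axis.\<close>
  define I where "I = {0..int N} \<times> {0..int N}"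
  \<comment> \<open>This is the Fourier transform of \<open>gauss3 N Z\<close> at the difference of
    the two points.\<close>
  define k where "k p = exp (- ((fst (fst (fst p - snd p)) * N)\<^sup>2 + (snd (fst (fst p - snd p)) * N)\<^sup>2 + (snd (fst p - snd p) * Z)\<^sup>2) / 2)"
    for p :: "((real \<times> real) \<times> real) \<times> ((real \<times> real) \<times> real)"
  have [measurable]: "k \<in> borel_measurable (\<mu> \<Otimes>\<^sub>M \<mu>)"
  proof -
    have "continuous_on UNIV k" unfolding k_def by (intro continuous_intros) auto
    then have "k \<in> borel_measurable borel" by (rule borel_measurable_continuous_onI)
    then show ?thesis using measurable_cong_sets[OF sets_pair_borel[OF mu(2) mu(2)] refl] by blast
  qed
  have Am: "A i \<in> sets \<mu>" for i
  proof -
    define p q where pq: "p x = fst (fst x)" "q x = snd (fst x)" for x :: "(real \<times> real) \<times> real"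
    have [measurable]: "p \<in> borel_measurable borel" "q \<in> borel_measurable borel"
      unfolding pq by (intro borel_measurable_continuous_onI continuous_intros)+
    have "A i = G \<inter> {x \<in> space borel. \<lfloor>real N * p x\<rfloor> = fst i \<and> \<lfloor>real N * q x\<rfloor> = snd i}"
      by (auto simp: A_def pq split: prod.split)
    also have "\<dots> \<in> sets borel" by measurable
    finally show ?thesis by (simp add: mu(2))
  qed
  have Ad: "disjoint_family_on A I" by (auto simp: disjoint_family_on_def A_def)
  have fI: "finite I" by (simp add: I_def)
  have card: "card I = (N + 1)\<^sup>2" by (simp add: I_def power2_eq_square nat_add_distrib)
  have "exp (- 3 / 2) * (measure \<mu> (space \<mu>))\<^sup>2 \<le> card I * (LINT p|(\<mu> \<Otimes>\<^sub>M \<mu>). k p)"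
  proof (rule square_measure_le_card_times_energy[where A = A])
    show "AE x in \<mu>. x \<in> (\<Union>i\<in>I. A i)"
      using graph
    proof eventually_elim
      case (elim x)
      then obtain t where t: "x = (t, f t)" "t \<in> ?Q" by blast
      have fl: "\<lfloor>real N * r\<rfloor> \<in> {0..int N}" if "0 \<le> r" "r \<le> 1" for r :: real
        using that mult_left_mono[of r 1 "real N"] by (auto simp: floor_le_iff)
      have "x \<in> A (\<lfloor>real N * fst t\<rfloor>, \<lfloor>real N * snd t\<rfloor>)" using t by (auto simp: A_def G_def)
      moreover have "(\<lfloor>real N * fst t\<rfloor>, \<lfloor>real N * snd t\<rfloor>) \<in> I" unfolding I_def using t fl by auto
      ultimately show ?case by blast
    qed
    have "0 \<le> k p" "k p \<le> 1" for p
      unfolding k_def exp_le_one_iff minus_divide_left[symmetric] neg_le_0_iff_le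
      by (rule exp_ge_zero) (intro divide_nonneg_pos add_nonneg_nonneg; simp)
    then show "integrable (\<mu> \<Otimes>\<^sub>M \<mu>) k"
      by (intro P.integrable_const_bound[of _ 1]) auto
    fix i x y assume xy: "x \<in> A i" "y \<in> A i"
    then obtain t t' where t: "x = (t, f t)" "y = (t', f t')" "t \<in> ?Q" "t' \<in> ?Q"
      by (auto simp: A_def G_def split: prod.splits)
    have "\<lfloor>real N * fst t\<rfloor> = \<lfloor>real N * fst t'\<rfloor>" "\<lfloor>real N * snd t\<rfloor> = \<lfloor>real N * snd t'\<rfloor>"
      using xy t by (auto simp: A_def split: prod.splits)
    then have le1: "\<bar>real N * fst t - real N * fst t'\<bar> \<le> 1" "\<bar>real N * snd t - real N * snd t'\<bar> \<le> 1"
      by (auto intro: abs_diff_le_1_of_floor_eq)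
    then have "\<bar>fst t - fst t'\<bar> \<le> 1 / N" "\<bar>snd t - snd t'\<bar> \<le> 1 / N"
      using N(1) by (auto simp: abs_le_iff field_simps)
    then have "dist t t' < d"
      using norm_prod_le[of "t - t'"] N(2) by (simp add: dist_norm)
    then have "dist (f t) (f t') < 1 / Z" by (intro d(2) t)
    then have "\<bar>f t - f t'\<bar> * Z < 1"
      using \<open>Z > 0\<close> by (simp only: dist_real_def pos_less_divide_eq)
    then have le2: "\<bar>(f t - f t') * Z\<bar> \<le> 1"
      unfolding abs_mult using \<open>Z > 0\<close> by (simp only: abs_of_pos)
    have "((fst t - fst t') * N)\<^sup>2 \<le> 1" "((snd t - snd t') * N)\<^sup>2 \<le> 1" "((f t - f t') * Z)\<^sup>2 \<le> 1"
      using le1 le2 by (auto simp: abs_square_le_1 algebra_simps)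
    then show "exp (- 3 / 2) \<le> k (x, y)" by (simp add: k_def t)
  qed (auto simp: mu(1) Am Ad fI k_def)
  also have "space \<mu> = UNIV" using sets_eq_imp_space_eq[OF mu(2)] by simp
  also have "(LINT p|(\<mu> \<Otimes>\<^sub>M \<mu>). k p) = (LINT \<xi>|gauss3 (real N) Z. (cmod (LINT x|\<mu>. cis (\<xi> \<bullet> x)))\<^sup>2)"
  proof -
    have "of_real (LINT \<xi>|gauss3 (real N) Z. (cmod (LINT x|\<mu>. cis (\<xi> \<bullet> x)))\<^sup>2) =
      (LINT p|(\<mu> \<Otimes>\<^sub>M \<mu>). of_real (k p) :: complex)"
      using N \<open>Z > 0\<close> unfolding k_def
      by (subst integral_cmod_sq_char) (auto simp: mu finite_measure_gauss3 sets_gauss3 integral_cis_gauss3)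
    also have "\<dots> = of_real (LINT p|(\<mu> \<Otimes>\<^sub>M \<mu>). k p)" by (rule integral_complex_of_real)
    finally show ?thesis by (simp only: of_real_eq_iff)
  qed
  also have "real (card I) = (real N + 1)\<^sup>2" by (simp add: card)
  finally show thesis using N by (intro that[of N]) auto
qed

text \<open>If s = 2 + 3a with a > 0, the decay (1 + |\<xi>|)^(-s) is dominated by a product of
  one-dimensional weights with exponents 1 + a, 1 + a and a. Against the Gaussian the first two give
  K/N each, which cancels the number of cells, and the third tends to 0 as \<open>Z\<close> grows.
  The lower bound by the squared mass is then violated.\<close>

lemma fourier_exponent_graph_le_2:
  fixes f :: "real \<times> real \<Rightarrow> real" and \<mu> :: "((real \<times> real) \<times> real) measure"
  assumes cont: "continuous_on ({0..1} \<times> {0..1}) f"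
    and mu: "finite_measure \<mu>" "sets \<mu> = sets borel" and nz: "emeasure \<mu> UNIV \<noteq> 0"
    and graph: "AE x in \<mu>. x \<in> {(t, f t) | t. t \<in> {0..1} \<times> {0..1}}"
    and bdd: "bdd_above (range (\<lambda>\<xi>. (cmod (fourier_transform \<mu> \<xi>))\<^sup>2 * norm \<xi> powr s))"
  shows "s \<le> 2"
proof (rule ccontr)
  assume "\<not> s \<le> 2"
  \<comment> \<open>The excess over 2 is shared equally: the time weights need an exponent above 1
    to be integrable on the line, the value weight only a positive one.\<close>
  define a where "a = (s - 2) / 3"
  have a: "a > 0" "s = 2 + 3 * a" using \<open>\<not> s \<le> 2\<close> by (simp_all add: a_def field_simps)
  interpret mu: finite_measure \<mu> by fact
  note [measurable_cong] = mu(2)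
  define m where "m = measure \<mu> UNIV"
  have m: "m > 0" using nz by (simp add: m_def mu.emeasure_eq_measure zero_less_measure_iff)
  define u where "u \<xi> = (LINT x|\<mu>. cis (\<xi> \<bullet> x))" for \<xi>
  have um [measurable]: "u \<in> borel_measurable borel" unfolding u_def by measurable
  have um2: "(cmod (u \<xi>))\<^sup>2 \<le> m\<^sup>2" for \<xi>
  proof -
    have "cmod (u \<xi>) \<le> (LINT x|\<mu>. cmod (cis (\<xi> \<bullet> x)))" unfolding u_def by (rule integral_norm_bound)
    also have "\<dots> = m" using sets_eq_imp_space_eq[OF mu(2)] by (simp add: m_def)
    finally show ?thesis by (intro power_mono) auto
  qed
  obtain C0 where C0: "\<And>\<xi>. (cmod (fourier_transform \<mu> \<xi>))\<^sup>2 * norm \<xi> powr s \<le> C0"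
    using bdd by (auto simp: bdd_above_def)
  \<comment> \<open>Comes from (1 + r)^s \<le> 2^s (1 + r^s): the total mass controls the term 1,
    the assumed decay the term r^s. The power of 2 pi converts between \<open>u\<close>, whose phase
    has no 2 pi, and \<open>fourier_transform\<close>.\<close>
  define C where "C = 2 powr s * (m\<^sup>2 + C0 * (2 * pi) powr s)"
  have C0': "(cmod (u \<xi>))\<^sup>2 * norm \<xi> powr s \<le> C0 * (2 * pi) powr s" for \<xi>
  proof -
    have "u \<xi> = fourier_transform \<mu> ((- 1 / (2 * pi)) *\<^sub>R \<xi>)"
      by (simp add: fourier_transform_conv_cis u_def)
    moreover have "norm \<xi> powr s = norm ((- 1 / (2 * pi)) *\<^sub>R \<xi>) powr s * (2 * pi) powr s"
      by (simp add: powr_mult[symmetric])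
    ultimately show ?thesis
      using mult_right_mono[OF C0[of "(- 1 / (2 * pi)) *\<^sub>R \<xi>"], of "(2 * pi) powr s"] by (simp add: mult_ac)
  qed
  have "0 \<le> C0 * (2 * pi) powr s" using order_trans[OF _ C0'[of 0]] by simp
  then have C: "C \<ge> 0" by (simp add: C_def)
  define h where "h x = (1 + \<bar>x\<bar>) powr (-(1 + a))" for x :: real
  define h' where "h' x = (1 + \<bar>x\<bar>) powr (- a)" for x :: real
  have [measurable]: "h \<in> borel_measurable borel" "h' \<in> borel_measurable borel"
    unfolding h_def h'_def by measurable
  have uH: "(cmod (u \<xi>))\<^sup>2 \<le> C * (h (fst (fst \<xi>)) * h (snd (fst \<xi>)) * h' (snd \<xi>))" for \<xi>
  proof -
    define r where "r = norm \<xi>"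
    have "(1 + r) powr s \<le> 2 powr s * (1 + r powr s)"
    proof (cases "r \<le> 1")
      case True
      then have "(1 + r) powr s \<le> 2 powr s" using a by (intro powr_mono2) (auto simp: r_def)
      also have "\<dots> \<le> 2 powr s * (1 + r powr s)" by simp
      finally show ?thesis .
    next
      case False
      then have "(1 + r) powr s \<le> (2 * r) powr s" using a by (intro powr_mono2) auto
      also have "\<dots> = 2 powr s * r powr s" using False by (simp add: powr_mult)
      also have "\<dots> \<le> 2 powr s * (1 + r powr s)" by simp
      finally show ?thesis .
    qed
    then have "(cmod (u \<xi>))\<^sup>2 * (1 + r) powr s \<le> (cmod (u \<xi>))\<^sup>2 * (2 powr s * (1 + r powr s))"
      by (rule mult_left_mono) simp
    also have "\<dots> = 2 powr s * ((cmod (u \<xi>))\<^sup>2 + (cmod (u \<xi>))\<^sup>2 * norm \<xi> powr s)"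
      by (simp add: algebra_simps r_def)
    also have "\<dots> \<le> C" unfolding C_def by (intro mult_left_mono add_mono um2 C0') auto
    finally have "(cmod (u \<xi>))\<^sup>2 \<le> C * (1 + r) powr (- s)"
      using norm_ge_zero[of \<xi>] by (simp add: powr_minus r_def add_nonneg_eq_0_iff pos_le_divide_eq flip: divide_inverse)
    also have "(1 + r) powr (- s) = (1 + r) powr (-(1 + a)) * (1 + r) powr (-(1 + a)) * (1 + r) powr (- a)"
      by (simp add: powr_add[symmetric] a(2) algebra_simps)
    also have "\<dots> \<le> h (fst (fst \<xi>)) * h (snd (fst \<xi>)) * h' (snd \<xi>)"
    proof -
      have "norm (snd \<xi>) \<le> r" "norm (fst \<xi>) \<le> r" "norm (fst (fst \<xi>)) \<le> norm (fst \<xi>)" "norm (snd (fst \<xi>)) \<le> norm (fst \<xi>)"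
        unfolding r_def
        using norm_snd_le[of "snd \<xi>" "fst \<xi>"] norm_fst_le[of "fst \<xi>" "snd \<xi>"]
          norm_snd_le[of "snd (fst \<xi>)" "fst (fst \<xi>)"] norm_fst_le[of "fst (fst \<xi>)" "snd (fst \<xi>)"]
        by simp_all
      then have "\<bar>fst (fst \<xi>)\<bar> \<le> r" "\<bar>snd (fst \<xi>)\<bar> \<le> r" "\<bar>snd \<xi>\<bar> \<le> r" by auto
      then show ?thesis
        unfolding h_def h'_def using a by (intro mult_mono powr_mono2') auto
    qed
    finally show ?thesis using C by (simp add: mult_left_mono)
  qed
  obtain K where K: "K \<ge> 0"
    "\<And>\<sigma>. \<sigma> > 0 \<Longrightarrow> (\<integral>\<^sup>+x. ennreal (h x) \<partial>density lborel (normal_density 0 \<sigma>)) \<le> ennreal (K / \<sigma>)"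
    using nn_integral_powr_normal_le[OF a(1)] unfolding h_def by metis
  define e where "e n = (LINT x|density lborel (normal_density 0 (real (Suc n))). h' x)" for n
  have e0: "e n \<ge> 0" for n unfolding e_def h'_def by (intro Bochner_Integration.integral_nonneg) auto
  have e: "e \<longlonglongrightarrow> 0" unfolding e_def h'_def by (rule integral_powr_normal_tendsto_0[OF a(1)])
  \<comment> \<open>The right side is free of \<open>N\<close>, although \<open>N\<close> depends on
    \<open>n\<close> through the modulus of continuity. The 4 comes from N + 1 \<le> 2N.\<close>
  have "exp (- 3 / 2) * m\<^sup>2 \<le> 4 * C * K\<^sup>2 * e n" for n
  proof -
    define Z where "Z = real (Suc n)"
    have Z: "Z > 0" by (simp add: Z_def)
    obtain N :: nat where N: "N \<ge> 1"
      "exp (- 3 / 2) * m\<^sup>2 \<le> (real N + 1)\<^sup>2 * (LINT \<xi>|gauss3 (real N) Z. (cmod (u \<xi>))\<^sup>2)"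
      using graph_energy_ge[OF cont mu graph Z] unfolding m_def u_def by metis
    interpret g: finite_measure "gauss3 (real N) Z" using N Z by (intro finite_measure_gauss3) auto
    note [measurable_cong] = sets_gauss3[of "real N" Z]
    define D where "D \<sigma> = density lborel (normal_density 0 \<sigma>)" for \<sigma>
    have D: "prob_space (D s)" "sigma_finite_measure (D s)" "sets (D s) = sets borel" if "s > 0" for s
      using prob_space_normal_density[OF that, of 0]
      by (simp_all add: D_def finite_measure.axioms(1) prob_space_def)
    have [measurable_cong]: "sets (D s) = sets borel" for s by (simp add: D_def)
    have "ennreal (LINT \<xi>|gauss3 (real N) Z. (cmod (u \<xi>))\<^sup>2) = (\<integral>\<^sup>+\<xi>. ennreal ((cmod (u \<xi>))\<^sup>2) \<partial>gauss3 (real N) Z)"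
      by (intro nn_integral_eq_integral[symmetric] g.integrable_const_bound[of _ "m\<^sup>2"]) (auto simp: um2)
    also have "\<dots> \<le> (\<integral>\<^sup>+\<xi>. ennreal C * ((ennreal (h (fst (fst \<xi>))) * ennreal (h (snd (fst \<xi>)))) * ennreal (h' (snd \<xi>))) \<partial>gauss3 (real N) Z)"
      using C uH by (intro nn_integral_mono) (simp add: ennreal_mult[symmetric] h_def h'_def ennreal_leI)
    also have "\<dots> = ennreal C * (\<integral>\<^sup>+\<xi>. (\<lambda>p. ennreal (h (fst p)) * ennreal (h (snd p))) (fst \<xi>) * ennreal (h' (snd \<xi>)) \<partial>((D N \<Otimes>\<^sub>M D N) \<Otimes>\<^sub>M D Z))"
      unfolding gauss3_def D_def[symmetric] by (subst nn_integral_cmult) auto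
    also have "(\<integral>\<^sup>+\<xi>. (\<lambda>p. ennreal (h (fst p)) * ennreal (h (snd p))) (fst \<xi>) * ennreal (h' (snd \<xi>)) \<partial>((D N \<Otimes>\<^sub>M D N) \<Otimes>\<^sub>M D Z))
        = (\<integral>\<^sup>+p. ennreal (h (fst p)) * ennreal (h (snd p)) \<partial>(D N \<Otimes>\<^sub>M D N)) * (\<integral>\<^sup>+x. ennreal (h' x) \<partial>D Z)"
      by (intro nn_integral_pair_mult D Z) measurable
    also have "(\<integral>\<^sup>+p. ennreal (h (fst p)) * ennreal (h (snd p)) \<partial>(D N \<Otimes>\<^sub>M D N)) = (\<integral>\<^sup>+x. ennreal (h x) \<partial>D N) * (\<integral>\<^sup>+x. ennreal (h x) \<partial>D N)"
      using N by (intro nn_integral_pair_mult D) auto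
    also have "(\<integral>\<^sup>+x. ennreal (h' x) \<partial>D Z) = ennreal (e n)"
    proof -
      interpret DZ: prob_space "D Z" by (rule D[OF Z])
      have "h' x \<le> 1" for x
        using powr_mono[of "- a" 0 "1 + \<bar>x\<bar>"] a by (auto simp: h'_def split: if_splits)
      then show ?thesis unfolding e_def D_def[symmetric] Z_def[symmetric]
        by (intro nn_integral_eq_integral DZ.integrable_const_bound[of _ 1]) (auto simp: h'_def)
    qed
    also have "ennreal C * ((\<integral>\<^sup>+x. ennreal (h x) \<partial>D N) * (\<integral>\<^sup>+x. ennreal (h x) \<partial>D N) * ennreal (e n))
        \<le> ennreal C * (ennreal (K / N) * ennreal (K / N) * ennreal (e n))"
      unfolding D_def using N by (intro mult_mono mult_right_mono mult_left_mono K) auto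
    also have "\<dots> = ennreal (C * (K / N * (K / N) * e n))"
      using C K(1) e0[of n]
      by (simp only: ennreal_mult'[symmetric] divide_nonneg_nonneg of_nat_0_le_iff mult_nonneg_nonneg)
    finally have "(LINT \<xi>|gauss3 (real N) Z. (cmod (u \<xi>))\<^sup>2) \<le> C * (K / N * (K / N) * e n)"
      using C K e0 by (subst (asm) ennreal_le_iff) auto
    then have "(real N + 1)\<^sup>2 * (LINT \<xi>|gauss3 (real N) Z. (cmod (u \<xi>))\<^sup>2) \<le> (2 * real N)\<^sup>2 * (C * (K / N * (K / N) * e n))"
      using N C K e0 by (intro mult_mono power_mono Bochner_Integration.integral_nonneg) auto
    also have "\<dots> = 4 * C * K\<^sup>2 * e n" using N by (simp add: field_simps power2_eq_square)
    finally show ?thesis using N by simp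
  qed
  moreover have "(\<lambda>n. 4 * C * K\<^sup>2 * e n) \<longlonglongrightarrow> 4 * C * K\<^sup>2 * 0" by (intro tendsto_intros e)
  ultimately have "exp (- 3 / 2) * m\<^sup>2 \<le> 4 * C * K\<^sup>2 * 0" by (intro LIMSEQ_le_const) auto
  moreover have "exp (- 3 / 2) * m\<^sup>2 > 0" using m by simp
  ultimately show False by simp
qed

section \<open>Exponential moments along Brownian paths\<close>

lemma Re_mult_sq_le:
  assumes "cmod c \<le> 1"
  shows "(Re (c * w))\<^sup>2 \<le> (cmod w)\<^sup>2"
proof -
  have "\<bar>Re (c * w)\<bar> \<le> cmod c * cmod w" using abs_Re_le_cmod[of "c*w"] by (simp add: norm_mult)
  also have "\<dots> \<le> cmod w" using assms by (simp add: mult_left_le_one_le)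
  finally show ?thesis by (metis abs_le_square_iff abs_norm_cancel)
qed

text \<open>One martingale increment. The variable Y = Re (c (cis (z x) - m)) is centred because m
  is the mean of cis (z x), and l Y \<le> 1, so exp (l Y) is at most 1 + l Y plus l^2 times the
  squared modulus of cis (z x) - m. The latter has mean 1 - m^2 \<le> (z \<sigma>)^2, and 1 + u
  \<le> exp u closes the estimate in a form that multiplies well.\<close>

lemma normal_exp_step:
  fixes c :: complex and z \<sigma> l :: real
  assumes "\<sigma> > 0" "cmod c \<le> 1" "0 \<le> l" "l \<le> 1/2"
  defines "N \<equiv> density lborel (normal_density 0 \<sigma>)"
  shows "(\<integral>\<^sup>+x. ennreal (exp (l * Re (c * (cis (z * x) - exp (- (z * \<sigma>)\<^sup>2 / 2))))) \<partial>N)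
      \<le> ennreal (exp (l\<^sup>2 * (z * \<sigma>)\<^sup>2))"
proof -
  interpret N: prob_space N unfolding N_def by (rule prob_space_normal_density) fact
  have sets[measurable_cong, simp]: "sets N = sets borel" by (simp add: N_def)
  define m where "m = exp (- (z * \<sigma>)\<^sup>2 / 2)"
  have m: "0 < m" "m \<le> 1" by (auto simp: m_def)
  define Y where "Y x = Re (c * (cis (z * x) - m))" for x
  define Q where "Q x = (cmod (cis (z * x) - m))\<^sup>2" for x
  have [measurable]: "(\<lambda>x. cis (z * x)) \<in> borel_measurable borel"
    by (auto intro!: borel_measurable_continuous_onI continuous_intros)
  have [measurable]: "Y \<in> borel_measurable borel" "Q \<in> borel_measurable borel"
    unfolding Y_def Q_def by measurable
  have ci: "integrable N (\<lambda>x. cis (z * x))"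
    by (rule N.integrable_const_bound[of _ 1]) auto
  have E: "(LINT x|N. cis (z * x)) = of_real m"
    using integral_cis_normal[OF assms(1), of z] by (simp add: N_def m_def)
  have Yb: "\<bar>Y x\<bar> \<le> 2" for x
  proof -
    have "\<bar>Y x\<bar> \<le> cmod c * cmod (cis (z * x) - m)"
      unfolding Y_def using abs_Re_le_cmod by (metis norm_mult)
    also have "\<dots> \<le> 1 * (1 + 1)"
      using assms m norm_triangle_ineq4[of "cis (z*x)" "of_real m"] by (intro mult_mono) auto
    finally show ?thesis by simp
  qed
  have Yi: "integrable N Y" by (rule N.integrable_const_bound[of _ 2]) (use Yb in auto)
  have EY: "(LINT x|N. Y x) = 0"
    unfolding Y_def using ci E by (subst Bochner_Integration.integral_Re) (auto simp: N.prob_space)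
  have Qeq: "Q x = 1 + m\<^sup>2 - 2 * m * Re (cis (z * x))" for x
  proof -
    have "Q x = (cos (z * x) - m)\<^sup>2 + (sin (z * x))\<^sup>2" by (simp add: Q_def cmod_power2)
    also have "\<dots> = (sin (z * x))\<^sup>2 + (cos (z * x))\<^sup>2 + m\<^sup>2 - 2 * m * cos (z * x)"
      by (simp add: power2_eq_square algebra_simps)
    finally show ?thesis by simp
  qed
  have Qi: "integrable N Q"
    unfolding Qeq using integrable_Re[OF ci] by (intro Bochner_Integration.integrable_diff integrable_mult_right) auto
  have "(LINT x|N. Q x) = 1 - m\<^sup>2"
  proof -
    have "integrable N (\<lambda>x. Re (cis (z * x)))" "(LINT x|N. Re (cis (z * x))) = m"
      using integrable_Re[OF ci] Bochner_Integration.integral_Re[OF ci] E by auto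
    then show ?thesis unfolding Qeq
      by (subst Bochner_Integration.integral_diff) (auto simp: N.prob_space power2_eq_square simp del: cis.simps)
  qed
  also have "m\<^sup>2 = exp (- (z * \<sigma>)\<^sup>2)" by (simp add: m_def exp_double[symmetric])
  also have "1 - \<dots> \<le> (z * \<sigma>)\<^sup>2" using exp_ge_add_one_self[of "- (z * \<sigma>)\<^sup>2"] by linarith
  finally have EQ: "(LINT x|N. Q x) \<le> (z * \<sigma>)\<^sup>2" .
  have pt: "exp (l * Y x) \<le> 1 + l * Y x + l\<^sup>2 * Q x" for x
  proof -
    have "l * Y x \<le> l * 2" using Yb[of x] assms by (intro mult_left_mono) auto
    also have "\<dots> \<le> 1" using assms by simp
    finally have "l * Y x \<le> 1" .
    then have "exp (l * Y x) \<le> 1 + l * Y x + (l * Y x)\<^sup>2" by (rule exp_le_quadratic)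
    also have "(l * Y x)\<^sup>2 \<le> l\<^sup>2 * Q x"
      unfolding Y_def Q_def power_mult_distrib by (intro mult_left_mono Re_mult_sq_le assms) simp
    finally show ?thesis by simp
  qed
  have "(\<integral>\<^sup>+x. ennreal (exp (l * Y x)) \<partial>N) \<le> (\<integral>\<^sup>+x. ennreal (1 + l * Y x + l\<^sup>2 * Q x) \<partial>N)"
    by (intro nn_integral_mono ennreal_leI pt)
  also have "\<dots> = ennreal (LINT x|N. 1 + l * Y x + l\<^sup>2 * Q x)"
    using Yi Qi by (intro nn_integral_eq_integral) (auto intro!: AE_I2 order_trans[OF _ pt])
  also have "(LINT x|N. 1 + l * Y x + l\<^sup>2 * Q x) = 1 + l\<^sup>2 * (LINT x|N. Q x)"
    using Yi Qi EY by (simp add: N.prob_space)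
  also have "\<dots> \<le> 1 + l\<^sup>2 * (z * \<sigma>)\<^sup>2" using EQ by (simp add: mult_left_mono)
  also have "\<dots> \<le> exp (l\<^sup>2 * (z * \<sigma>)\<^sup>2)" by (rule exp_ge_add_one_self)
  finally show ?thesis by (simp add: Y_def m_def ennreal_leI)
qed

text \<open>Iterated conditioning: the factor \<open>g k\<close> sees the past only through the first \<open>k\<close> coordinates.\<close>

lemma nn_integral_prod_adapted_le:
  fixes N :: "real measure" and g :: "nat \<Rightarrow> (nat \<Rightarrow> real) \<Rightarrow> real \<Rightarrow> ennreal"
  assumes "prob_space N" and sets: "sets N = sets borel"
    and meas: "\<And>k n. k < n \<Longrightarrow> (\<lambda>x. g k x (x k)) \<in> borel_measurable (\<Pi>\<^sub>M i\<in>{..<n}. borel)"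
    and adapted: "\<And>k x x'. (\<And>i. i < k \<Longrightarrow> x i = x' i) \<Longrightarrow> g k x = g k x'"
    and step: "\<And>k x. (\<integral>\<^sup>+y. g k x y \<partial>N) \<le> K"
  shows "(\<integral>\<^sup>+x. (\<Prod>k<n. g k x (x k)) \<partial>(\<Pi>\<^sub>M i\<in>{..<n}. N)) \<le> K ^ n"
proof (induction n)
  case 0
  interpret prob_space "\<Pi>\<^sub>M i\<in>{..<0::nat}. N"
    using assms(1) by (intro prob_space_PiM)
  show ?case using emeasure_space_1 by simp
next
  case (Suc n)
  interpret N: prob_space N by fact
  interpret P: product_sigma_finite "\<lambda>_::nat. N" ..
  have S: "sets (\<Pi>\<^sub>M i\<in>{..<m}. N) = sets (\<Pi>\<^sub>M i\<in>{..<m}. borel :: real measure)" for m :: nat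
    using sets by (intro sets_PiM_cong) auto
  have meas': "(\<lambda>x. g k x (x k)) \<in> borel_measurable (\<Pi>\<^sub>M i\<in>{..<m}. N)" if "k < m" for k m
    using meas[OF that] measurable_cong_sets[OF S refl] by blast
  have m2: "(\<lambda>x. \<Prod>k<m. g k x (x k)) \<in> borel_measurable (\<Pi>\<^sub>M i\<in>{..<m}. N)" for m
    by (intro borel_measurable_prod_ennreal meas') auto
  \<comment> \<open>Includes k = n: the newest factor sees coordinate \<open>n\<close> only through
    its last argument. The innermost integral therefore treats all the earlier factors as
    constants.\<close>
  have ad: "g k (x(n := y)) = g k x" if "k \<le> n" for k x y
    using that by (intro adapted) auto
  have "(\<integral>\<^sup>+x. (\<Prod>k<Suc n. g k x (x k)) \<partial>(\<Pi>\<^sub>M i\<in>{..<Suc n}. N))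
    = (\<integral>\<^sup>+x. (\<integral>\<^sup>+y. (\<Prod>k<Suc n. g k (x(n:=y)) ((x(n:=y)) k)) \<partial>N) \<partial>(\<Pi>\<^sub>M i\<in>{..<n}. N))"
    using P.product_nn_integral_insert[of "{..<n}" n "\<lambda>x. (\<Prod>k<Suc n. g k x (x k))"] m2[of "Suc n"]
    by (simp add: lessThan_Suc)
  also have "\<dots> = (\<integral>\<^sup>+x. (\<integral>\<^sup>+y. (\<Prod>k<n. g k x (x k)) * g n x y \<partial>N) \<partial>(\<Pi>\<^sub>M i\<in>{..<n}. N))"
    by (intro nn_integral_cong) (simp add: ad)
  also have "\<dots> \<le> (\<integral>\<^sup>+x. (\<Prod>k<n. g k x (x k)) * K \<partial>(\<Pi>\<^sub>M i\<in>{..<n}. N))"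
  proof (intro nn_integral_mono)
    fix x :: "nat \<Rightarrow> real" assume x: "x \<in> space (\<Pi>\<^sub>M i\<in>{..<n}. N)"
    have x': "x \<in> space (\<Pi>\<^sub>M i\<in>{..<n}. borel)" using x by (simp add: S sets_eq_imp_space_eq[OF S])
    have "(\<lambda>y. x(n := y)) \<in> borel \<rightarrow>\<^sub>M (\<Pi>\<^sub>M i\<in>{..<Suc n}. borel)"
      unfolding lessThan_Suc using x' by measurable
    from measurable_compose[OF this meas[of n "Suc n"]]
    have "(\<lambda>y. g n x y) \<in> borel_measurable borel" by (simp add: ad)
    then have "(\<lambda>y. g n x y) \<in> borel_measurable N" using measurable_cong_sets[OF sets refl] by blast
    then show "(\<integral>\<^sup>+y. (\<Prod>k<n. g k x (x k)) * g n x y \<partial>N) \<le> (\<Prod>k<n. g k x (x k)) * K"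
      by (simp add: nn_integral_cmult mult_left_mono step)
  qed
  also have "\<dots> = (\<integral>\<^sup>+x. (\<Prod>k<n. g k x (x k)) \<partial>(\<Pi>\<^sub>M i\<in>{..<n}. N)) * K"
    by (intro nn_integral_multc m2)
  also have "\<dots> \<le> K ^ n * K" by (intro mult_right_mono Suc.IH) auto
  finally show ?case by (simp add: mult.commute)
qed

text \<open>A discrete substitute for Ito's formula: when \<open>r * X k\<close> is the conditional
  mean of \<open>X (Suc k)\<close>, the last sum consists of martingale differences and only two
  boundary terms remain.\<close>

lemma sum_diff_telescope:
  fixes X :: "nat \<Rightarrow> complex"
  shows "(1 - r) * (\<Sum>k<n. X k) = X 0 - X n + (\<Sum>k<n. X (Suc k) - r * X k)"
proof (induction n)
  case (Suc n)
  have "(1 - r) * (\<Sum>k<Suc n. X k) = (1 - r) * (\<Sum>k<n. X k) + (X n - r * X n)"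
    by (simp add: algebra_simps)
  then show ?case unfolding Suc by simp
qed simp

text \<open>The modulus is at most twice the largest of the real parts of v, -v, \<i> v and -\<i> v.
  Exponential moments of a modulus thus reduce to those of real parts in four directions.\<close>

lemma exp_cmod_le_sum:
  assumes "d > 0"
  shows "exp (cmod v / (4 * d)) \<le> (\<Sum>c\<in>{1, -1, \<i>, -\<i>}. exp (Re (c * v) / (2 * d)))"
proof -
  have "cmod v \<le> \<bar>Re v\<bar> + \<bar>Im v\<bar>" by (rule cmod_le)
  then have "cmod v \<le> 2 * Re (1 * v) \<or> cmod v \<le> 2 * Re (-1 * v) \<or> cmod v \<le> 2 * Re (\<i> * v) \<or> cmod v \<le> 2 * Re (- \<i> * v)"
    by (auto simp: abs_if split: if_splits)
  then obtain c where c: "c \<in> {1, -1, \<i>, -\<i>}" "cmod v \<le> 2 * Re (c * v)" by blast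
  have "exp (cmod v / (4 * d)) \<le> exp (Re (c * v) / (2 * d))"
    using c(2) assms by (simp add: divide_simps)
  also have "\<dots> \<le> (\<Sum>c\<in>{1, -1, \<i>, -\<i>}. exp (Re (c * v) / (2 * d)))"
    using c(1) by (intro member_le_sum) auto
  finally show ?thesis .
qed

text \<open>With w = \<i> a - z^2/2, the prefactor is asymptotic to -w/n, so this approximates -w
  times the oscillatory integral of the path. The exact exponential in place of -w/n makes the
  telescoping identity exact for every \<open>n\<close>; subtracting \<open>b 0\<close> makes the
  summands functions of the increments alone.\<close>

definition path_sum :: "(real \<Rightarrow> real) \<Rightarrow> real \<Rightarrow> real \<Rightarrow> nat \<Rightarrow> complex" where
  "path_sum b a z n = (1 - exp ((\<i> * of_real a - of_real (z\<^sup>2 / 2)) / of_nat n)) *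
     (\<Sum>k<n. cis (a * (real k / real n) + z * (b (real k / real n) - b 0)))"

section \<open>Moment bounds for the discretised path integrals\<close>

context standard_brownian_motion
begin

lemma distr_increments:
  assumes "n > (0::nat)"
  defines "D \<equiv> \<lambda>i \<omega>. B (Suc i / n) \<omega> - B (i / n) \<omega>"
  shows "distr M (\<Pi>\<^sub>M i\<in>{..<n}. borel) (\<lambda>\<omega>. \<lambda>i\<in>{..<n}. D i \<omega>) =
    (\<Pi>\<^sub>M i\<in>{..<n}. density lborel (normal_density 0 (sqrt (1 / n))))"
proof -
  have D: "distr M borel (D i) = density lborel (normal_density 0 (sqrt (1 / n)))" if "i < n" for i
  proof -
    have "distributed M lborel (D i) (normal_density 0 (sqrt (Suc i / n - i / n)))"
      unfolding D_def using that by (intro normal_increments) (auto simp: field_simps)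
    moreover have "Suc i / n - i / n = 1 / n" using assms by (simp add: field_simps)
    ultimately have "distr M lborel (D i) = density lborel (normal_density 0 (sqrt (1 / n)))"
      by (simp add: distributed_distr_eq_density)
    then show ?thesis by (simp cong: distr_cong)
  qed
  have "indep_vars (\<lambda>_. borel) D {..<n}"
    unfolding D_def using assms
    by (intro indep_increments[of "\<lambda>i. real i / n" n]) (auto simp: strict_mono_on_def divide_simps)
  moreover have "random_variable borel (D i)" if "i \<in> {..<n}" for i
    unfolding D_def using that by (intro borel_measurable_diff measurable_B) (auto simp: field_simps)
  ultimately have "distr M (\<Pi>\<^sub>M i\<in>{..<n}. borel) (\<lambda>\<omega>. \<lambda>i\<in>{..<n}. D i \<omega>) = (\<Pi>\<^sub>M i\<in>{..<n}. distr M borel (D i))"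
    using assms by (subst indep_vars_iff_distr_eq_PiM'[symmetric]) auto
  also have "\<dots> = (\<Pi>\<^sub>M i\<in>{..<n}. density lborel (normal_density 0 (sqrt (1 / n))))"
    by (intro PiM_cong) (auto simp: D)
  finally show ?thesis .
qed

text \<open>With \<open>r = exp ((\<i> a - z\<^sup>2 / 2) / n)\<close> and \<open>X k\<close> the \<open>k\<close>-th summand of \<^const>\<open>path_sum\<close>, the
  terms \<open>X (k + 1) - r X k\<close> are martingale differences, bounded by \<open>2\<close> and of conditional second moment
  at most \<open>z\<^sup>2 / n\<close>; their sum is \<^const>\<open>path_sum\<close> up to two boundary terms. Hence the exponential
  moments at scale \<open>1 + \<bar>z\<bar>\<close> are bounded uniformly in \<open>n\<close>.\<close>

lemma exp_moment_Re:
  assumes "n > 0" "cmod c \<le> 1"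
  shows "(\<integral>\<^sup>+\<omega>. ennreal (exp (Re (c * path_sum (\<lambda>t. B t \<omega>) a z n) / (2 * (1 + \<bar>z\<bar>)))) \<partial>M) \<le> ennreal (exp 2)"
proof -
  \<comment> \<open>Small enough for \<open>normal_exp_step\<close>, and with l |z| bounded so that
    the accumulated variance l^2 z^2 stays bounded.\<close>
  define l where "l = 1 / (2 * (1 + \<bar>z\<bar>))"
  have l: "0 \<le> l" "l \<le> 1/2" "l * \<bar>z\<bar> \<le> 1/2" by (auto simp: l_def field_simps)
  define m where "m = exp (- (z * sqrt (1 / n))\<^sup>2 / 2)"
  define r where "r = exp ((\<i> * of_real a - of_real (z\<^sup>2 / 2)) / of_nat n)"
  \<comment> \<open>Here \<open>m\<close> is the mean of cis (z x) for a single increment x, so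
    \<open>r\<close> is the factor by which the conditional mean of the next summand differs from
    the current one.\<close>
  have r: "r = cis (a / n) * of_real m"
  proof -
    have e: "(\<i> * of_real a - of_real (z\<^sup>2 / 2)) / of_nat n = \<i> * of_real (a / n) + of_real (- (z * sqrt (1 / n))\<^sup>2 / 2)"
      using assms by (simp add: power_mult_distrib field_simps)
    show ?thesis unfolding r_def e exp_add m_def cis_conv_exp exp_of_real ..
  qed
  define X where "X k x = cis (a * (real k / real n) + z * (\<Sum>j<k. x j))" for k and x :: "nat \<Rightarrow> real"
  define g where "g k x y = ennreal (exp (l * Re (c * X k x * cis (a / n) * (cis (z * y) - of_real m))))"
    for k x y
  have X_Suc: "X (Suc k) x - r * X k x = X k x * cis (a / n) * (cis (z * x k) - of_real m)" for k x
  proof -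
    have "X (Suc k) x = X k x * cis (a / n) * cis (z * x k)"
      by (simp add: X_def cis_mult add_divide_distrib algebra_simps)
    then show ?thesis by (simp add: r algebra_simps)
  qed
  define D where "D i \<omega> = B (Suc i / n) \<omega> - B (i / n) \<omega>" for i \<omega>
  define x where "x \<omega> = (\<lambda>i\<in>{..<n}. D i \<omega>)" for \<omega>
  define N where "N = density lborel (normal_density 0 (sqrt (1 / n)))"
  have xs: "(\<Sum>j<k. x \<omega> j) = B (real k / real n) \<omega> - B 0 \<omega>" if "k \<le> n" for k \<omega>
    using that by (induction k) (auto simp: x_def D_def)
  have path: "path_sum (\<lambda>t. B t \<omega>) a z n = X 0 (x \<omega>) - X n (x \<omega>)
      + (\<Sum>k<n. X k (x \<omega>) * cis (a / n) * (cis (z * x \<omega> k) - of_real m))" for \<omega>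
  proof -
    have "(\<Sum>k<n. cis (a * (real k / real n) + z * (B (real k / real n) \<omega> - B 0 \<omega>))) = (\<Sum>k<n. X k (x \<omega>))"
      by (intro sum.cong) (auto simp: X_def xs)
    then show ?thesis unfolding path_sum_def r_def[symmetric]
      by (simp add: sum_diff_telescope[of r "\<lambda>k. X k (x \<omega>)"] X_Suc)
  qed
  have pt: "ennreal (exp (Re (c * path_sum (\<lambda>t. B t \<omega>) a z n) * l)) \<le> ennreal (exp 1) * (\<Prod>k<n. g k (x \<omega>) (x \<omega> k))" for \<omega>
  proof -
    have "Re (c * (X 0 (x \<omega>) - X n (x \<omega>))) \<le> cmod c * cmod (X 0 (x \<omega>) - X n (x \<omega>))"
      using complex_Re_le_cmod norm_mult by metis
    also have "\<dots> \<le> 1 * (1 + 1)"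
      using assms norm_triangle_ineq4[of "X 0 (x \<omega>)" "X n (x \<omega>)"] by (intro mult_mono) (auto simp: X_def)
    \<comment> \<open>The two boundary terms cost at most 1 in the exponent, hence the factor
      \<open>exp 1\<close>.\<close>
    finally have "l * Re (c * (X 0 (x \<omega>) - X n (x \<omega>))) \<le> 1/2 * 2" using l by (intro order_trans[OF mult_left_mono mult_right_mono]) auto
    moreover have "l * Re (c * path_sum (\<lambda>t. B t \<omega>) a z n) = l * Re (c * (X 0 (x \<omega>) - X n (x \<omega>)))
       + (\<Sum>k<n. l * Re (c * X k (x \<omega>) * cis (a / n) * (cis (z * x \<omega> k) - of_real m)))"
      unfolding path by (simp only: distrib_left sum_distrib_left plus_complex.simps Re_sum mult.assoc)
    ultimately have "l * Re (c * path_sum (\<lambda>t. B t \<omega>) a z n)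
       \<le> 1 + (\<Sum>k<n. l * Re (c * X k (x \<omega>) * cis (a / n) * (cis (z * x \<omega> k) - of_real m)))" by simp
    then have "exp (l * Re (c * path_sum (\<lambda>t. B t \<omega>) a z n))
       \<le> exp 1 * (\<Prod>k<n. exp (l * Re (c * X k (x \<omega>) * cis (a / n) * (cis (z * x \<omega> k) - of_real m))))"
      by (simp add: exp_sum[symmetric] exp_add[symmetric])
    then show ?thesis unfolding g_def
      by (subst prod_ennreal) (auto simp: ennreal_mult[symmetric] prod_nonneg mult.commute intro!: ennreal_leI)
  qed
  have step: "(\<integral>\<^sup>+y. g k x y \<partial>N) \<le> ennreal (exp (l\<^sup>2 * (z * sqrt (1 / n))\<^sup>2))" for k x
    unfolding g_def N_def m_def using assms l
    by (intro normal_exp_step) (auto simp: norm_mult X_def)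
  have gm: "(\<lambda>x. g k x (x k)) \<in> borel_measurable (\<Pi>\<^sub>M i\<in>{..<j}. borel)" if "k < j" for k j
  proof -
    have [measurable]: "cis \<in> borel_measurable borel"
      by (auto intro!: borel_measurable_continuous_onI continuous_intros)
    have [measurable]: "(\<lambda>x. x i) \<in> borel_measurable (\<Pi>\<^sub>M i\<in>{..<j}. (borel :: real measure))" if "i \<le> k" for i
      using that \<open>k < j\<close> by (intro measurable_component_singleton) auto
    have "(\<lambda>x. \<Sum>i<k. x i) \<in> borel_measurable (\<Pi>\<^sub>M i\<in>{..<j}. (borel :: real measure))"
      by (intro borel_measurable_sum) auto
    then show ?thesis unfolding g_def X_def by measurable
  qed
  have xm: "x \<in> M \<rightarrow>\<^sub>M (\<Pi>\<^sub>M i\<in>{..<n}. borel)"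
    unfolding x_def D_def
    by (intro measurable_restrict borel_measurable_diff measurable_B) (auto simp: field_simps)
  have "(\<integral>\<^sup>+\<omega>. ennreal (exp (Re (c * path_sum (\<lambda>t. B t \<omega>) a z n) * l)) \<partial>M)
      \<le> (\<integral>\<^sup>+\<omega>. ennreal (exp 1) * (\<Prod>k<n. g k (x \<omega>) (x \<omega> k)) \<partial>M)"
    by (intro nn_integral_mono pt)
  also have "\<dots> = (\<integral>\<^sup>+x. ennreal (exp 1) * (\<Prod>k<n. g k x (x k)) \<partial>distr M (\<Pi>\<^sub>M i\<in>{..<n}. borel) x)"
    using xm gm by (subst nn_integral_distr) auto
  also have "distr M (\<Pi>\<^sub>M i\<in>{..<n}. borel) x = (\<Pi>\<^sub>M i\<in>{..<n}. N)"
    using distr_increments[OF assms(1)] by (simp add: N_def x_def[abs_def] D_def)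
  also have "(\<integral>\<^sup>+x. ennreal (exp 1) * (\<Prod>k<n. g k x (x k)) \<partial>(\<Pi>\<^sub>M i\<in>{..<n}. N)) =
      ennreal (exp 1) * (\<integral>\<^sup>+x. (\<Prod>k<n. g k x (x k)) \<partial>(\<Pi>\<^sub>M i\<in>{..<n}. N))"
  proof (intro nn_integral_cmult borel_measurable_prod_ennreal)
    fix k assume k: "k \<in> {..<n}"
    have "sets (\<Pi>\<^sub>M i\<in>{..<n}. N) = sets (\<Pi>\<^sub>M i\<in>{..<n}. borel :: real measure)"
      by (intro sets_PiM_cong) (auto simp: N_def)
    with gm[of k n] k show "(\<lambda>x. g k x (x k)) \<in> borel_measurable (\<Pi>\<^sub>M i\<in>{..<n}. N)"
      using measurable_cong_sets[OF _ refl] by (metis lessThan_iff)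
  qed
  also have "\<dots> \<le> ennreal (exp 1) * ennreal (exp (l\<^sup>2 * (z * sqrt (1 / n))\<^sup>2)) ^ n"
  proof (intro mult_left_mono nn_integral_prod_adapted_le gm step)
    show "prob_space N" unfolding N_def using assms by (intro prob_space_normal_density) simp
    fix k and x x' :: "nat \<Rightarrow> real" assume "\<And>i. i < k \<Longrightarrow> x i = x' i"
    then have "X k x = X k x'" by (simp add: X_def)
    then show "g k x = g k x'" by (simp add: g_def fun_eq_iff)
  qed (auto simp: N_def)
  \<comment> \<open>The \<open>n\<close> factors with exponent l^2 z^2 / n multiply to a bound
    independent of \<open>n\<close>; as l |z| \<le> 1/2, the total exponent is at most 5/4.\<close>
  also have "\<dots> = ennreal (exp (1 + (l * \<bar>z\<bar>)\<^sup>2))"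
    using assms by (simp add: ennreal_power exp_of_nat_mult[symmetric] ennreal_mult[symmetric] exp_add power_mult_distrib)
  also have "\<dots> \<le> ennreal (exp 2)"
    using l(3) power_mono[OF l(3), of 2] l(1) by (intro ennreal_leI) (simp add: power_divide)
  finally show ?thesis by (simp add: l_def)
qed

lemma measurable_path_sum [measurable]:
  "(\<lambda>\<omega>. path_sum (\<lambda>t. B t \<omega>) a z n) \<in> borel_measurable M"
proof -
  have [measurable]: "cis \<in> borel_measurable borel"
    by (auto intro!: borel_measurable_continuous_onI continuous_intros)
  have [measurable]: "B 0 \<in> borel_measurable M" by (intro measurable_B) auto
  have "(\<lambda>\<omega>. \<Sum>k<n. cis (a * (real k / real n) + z * (B (real k / real n) \<omega> - B 0 \<omega>))) \<in> borel_measurable M"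
  proof (intro borel_measurable_sum)
    fix k assume "k \<in> {..<n}"
    then have [measurable]: "B (real k / real n) \<in> borel_measurable M" by (intro measurable_B) auto
    show "(\<lambda>\<omega>. cis (a * (real k / real n) + z * (B (real k / real n) \<omega> - B 0 \<omega>))) \<in> borel_measurable M" by measurable
  qed
  then show ?thesis unfolding path_sum_def by measurable
qed

lemma exp_moment_cmod:
  assumes "n > 0"
  shows "(\<integral>\<^sup>+\<omega>. ennreal (exp (cmod (path_sum (\<lambda>t. B t \<omega>) a z n) / (4 * (1 + \<bar>z\<bar>)))) \<partial>M) \<le> ennreal (4 * exp 2)"
proof -
  let ?v = "\<lambda>\<omega>. path_sum (\<lambda>t. B t \<omega>) a z n"
  have "(\<integral>\<^sup>+\<omega>. ennreal (exp (cmod (?v \<omega>) / (4 * (1 + \<bar>z\<bar>)))) \<partial>M)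
      \<le> (\<integral>\<^sup>+\<omega>. (\<Sum>c\<in>{1, -1, \<i>, -\<i>}. ennreal (exp (Re (c * ?v \<omega>) / (2 * (1 + \<bar>z\<bar>))))) \<partial>M)"
    by (intro nn_integral_mono, subst sum_ennreal, simp, intro ennreal_leI exp_cmod_le_sum) simp
  also have "\<dots> = (\<Sum>c\<in>{1, -1, \<i>, -\<i>}. \<integral>\<^sup>+\<omega>. ennreal (exp (Re (c * ?v \<omega>) / (2 * (1 + \<bar>z\<bar>)))) \<partial>M)"
    by (intro nn_integral_sum) measurable
  also have "\<dots> \<le> (\<Sum>c\<in>{1, -1, \<i>, -\<i>}. ennreal (exp 2))"
    using assms by (intro sum_mono exp_moment_Re) auto
  also have "\<dots> = of_nat (card {1, -1, \<i>, -\<i>}) * ennreal (exp 2)" by simp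
  also have "\<dots> = ennreal (4 * exp 2)"
    by (simp add: complex_eq_iff ennreal_mult)
  finally show ?thesis .
qed

text \<open>A lower limit of discretisations is measurable on the whole space, and Fatou's lemma
  carries the moment bound over to it. On a continuous path it is a true limit, expressed by the
  path integral.\<close>

definition exp_liminf :: "real \<Rightarrow> real \<Rightarrow> 'w \<Rightarrow> ennreal" where
  "exp_liminf a z \<omega> = liminf (\<lambda>n. ennreal (exp (cmod (path_sum (\<lambda>t. B t \<omega>) a z n) / (4 * (1 + \<bar>z\<bar>)))))"

lemma measurable_exp_liminf [measurable]: "exp_liminf a z \<in> borel_measurable M"
  unfolding exp_liminf_def[abs_def] by measurable

lemma nn_integral_exp_liminf_le: "(\<integral>\<^sup>+\<omega>. exp_liminf a z \<omega> \<partial>M) \<le> ennreal (4 * exp 2)"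
proof -
  have "(\<integral>\<^sup>+\<omega>. exp_liminf a z \<omega> \<partial>M) \<le> liminf (\<lambda>n. \<integral>\<^sup>+\<omega>. ennreal (exp (cmod (path_sum (\<lambda>t. B t \<omega>) a z n) / (4 * (1 + \<bar>z\<bar>)))) \<partial>M)"
    unfolding exp_liminf_def by (intro nn_integral_liminf) measurable
  also have "\<dots> \<le> liminf (\<lambda>n. ennreal (4 * exp 2))"
    by (intro Liminf_mono eventually_sequentiallyI[of 1] exp_moment_cmod) auto
  finally show ?thesis by (simp add: Liminf_const)
qed

end

section \<open>Uniform decay for Brownian graphs\<close>

lemma riemann_sum_tendsto:
  fixes f :: "real \<Rightarrow> 'a::banach"
  assumes cont: "continuous_on {0..1} f"
  shows "(\<lambda>n. (1 / real n) *\<^sub>R (\<Sum>k<n. f (real k / real n))) \<longlonglongrightarrow> integral {0..1} f"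
proof (rule LIMSEQ_I)
  fix e :: real assume e: "e > 0"
  have "uniformly_continuous_on {0..1} f"
    by (rule compact_uniformly_continuous[OF cont]) simp
  then obtain d where d: "d > 0"
    "\<And>x y. x \<in> {0..1} \<Longrightarrow> y \<in> {0..1} \<Longrightarrow> dist y x < d \<Longrightarrow> dist (f y) (f x) < e / 2"
    unfolding uniformly_continuous_on_def using e by (metis half_gt_zero)
  obtain n0 :: nat where n0: "n0 > 0" "1 / n0 < d"
    using d(1) by (metis inverse_eq_divide ex_inverse_of_nat_less)
  have "norm ((1 / real n) *\<^sub>R (\<Sum>k<n. f (real k / real n)) - integral {0..1} f) < e" if n: "n \<ge> n0" for n
  proof -
    have np: "n > 0" using n n0 by simp
    have "1 / real n \<le> 1 / n0" using n n0 by (simp add: frac_le)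
    then have nd: "1 / real n < d" using n0 by simp
    have io: "f integrable_on {u..v}" if "0 \<le> u" "v \<le> 1" for u v
      using that by (intro integrable_continuous_interval continuous_on_subset[OF cont]) auto
    \<comment> \<open>Induction on the number of cells, each of which adds an error of at most
      (e/2)/n.\<close>
    have "norm (integral {0..m/n} f - (1 / real n) *\<^sub>R (\<Sum>k<m. f (real k / real n))) \<le> m * (e / 2 / n)"
      if "m \<le> n" for m
      using that
    proof (induction m)
      case (Suc m)
      have mn: "m / n \<le> Suc m / n" "Suc m / n \<le> 1" using Suc.prems np by (auto simp: field_simps)
      have len: "Suc m / n - m / n = 1 / n" using np by (simp add: field_simps)
      have 1: "integral {0..Suc m/n} f = integral {0..m/n} f + integral {m/n..Suc m/n} f"
        using mn by (intro Henstock_Kurzweil_Integration.integral_combine[symmetric] io) auto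
      have 2: "integral {m/n..Suc m/n} (\<lambda>t. f t - f (m/n)) = integral {m/n..Suc m/n} f - (1 / n) *\<^sub>R f (m/n)"
        using mn len by (subst Henstock_Kurzweil_Integration.integral_diff) (auto intro!: io)
      have 3: "norm (integral {m/n..Suc m/n} (\<lambda>t. f t - f (m/n))) \<le> e / 2 * (Suc m / n - m / n)"
      proof (rule integral_bound)
        show "continuous_on {m/n..Suc m/n} (\<lambda>t. f t - f (m/n))"
          using mn by (intro continuous_intros continuous_on_subset[OF cont]) auto
        fix t assume t: "t \<in> {m/n..Suc m/n}"
        then have "dist t (m/n) < d" using len nd by (auto simp: dist_real_def)
        moreover have "0 \<le> t" using t by (auto intro: order_trans[of 0 "m / n"])
        ultimately have "dist (f t) (f (m/n)) < e / 2" using t mn by (intro d(2)) (auto simp del: of_nat_Suc)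
        then show "norm (f t - f (m/n)) \<le> e / 2" by (simp add: dist_norm)
      qed (use mn in auto)
      have "integral {0..Suc m/n} f - (1 / real n) *\<^sub>R (\<Sum>k<Suc m. f (real k / real n)) =
          (integral {0..m/n} f - (1 / real n) *\<^sub>R (\<Sum>k<m. f (real k / real n))) + integral {m/n..Suc m/n} (\<lambda>t. f t - f (m/n))"
        unfolding 1 2 by (simp add: scaleR_add_right)
      also have "norm \<dots> \<le> m * (e / 2 / n) + e / 2 * (1 / n)"
        using Suc 3 len by (intro norm_triangle_le add_mono) auto
      also have "\<dots> = Suc m * (e / 2 / n)" by (simp add: algebra_simps add_divide_distrib)
      finally show ?case .
    qed simp
    from this[of n] np have "norm (integral {0..1} f - (1 / real n) *\<^sub>R (\<Sum>k<n. f (real k / real n))) \<le> e / 2"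
      by simp
    then show ?thesis using e by (simp add: norm_minus_commute)
  qed
  then show "\<exists>no. \<forall>n\<ge>no. norm ((1 / real n) *\<^sub>R (\<Sum>k<n. f (real k / real n)) - integral {0..1} f) < e" by blast
qed

lemma exp_divide_n_tendsto:
  "(\<lambda>n. of_nat n * (1 - exp (w / of_nat n))) \<longlonglongrightarrow> - w" for w :: complex
proof -
  have "((\<lambda>h. exp (w * h)) has_field_derivative w) (at 0)"
    by (auto intro!: derivative_eq_intros)
  then have "((\<lambda>h. (exp (w * h) - 1) / h) \<longlongrightarrow> w) (at 0)" by (simp add: DERIV_def)
  moreover have "filterlim (\<lambda>n. 1 / of_nat n :: complex) (at 0) sequentially"
    using lim_1_over_n by (auto simp: filterlim_at intro!: eventually_sequentiallyI[of 1])
  ultimately have "(\<lambda>n. (exp (w * (1 / of_nat n)) - 1) / (1 / of_nat n)) \<longlonglongrightarrow> w"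
    by (rule filterlim_compose)
  from tendsto_minus[OF this] show ?thesis by (simp add: algebra_simps)
qed

text \<open>The Fourier transform, up to the sign and the factor 2 pi in the frequency, of the
  push-forward of Lebesgue measure on the unit interval to the graph of \<open>b\<close>.\<close>

definition path_ft :: "(real \<Rightarrow> real) \<Rightarrow> real \<Rightarrow> real \<Rightarrow> complex" where
  "path_ft b a z = integral {0..1} (\<lambda>t. cis (a * t + z * b t))"

text \<open>The prefactor times n tends to -w, and the sum divided by n is a Riemann sum.
  Subtracting \<open>b 0\<close> only introduces a phase, which the modulus removes.\<close>

lemma cmod_path_sum_tendsto:
  assumes cont: "continuous_on {0..1} b"
  shows "(\<lambda>n. cmod (path_sum b a z n)) \<longlonglongrightarrow> cmod (\<i> * of_real a - of_real (z\<^sup>2 / 2)) * cmod (path_ft b a z)"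
proof -
  define w where "w = \<i> * of_real a - of_real (z\<^sup>2 / 2)"
  let ?f = "\<lambda>t. cis (a * t + z * (b t - b 0))"
  have "(\<lambda>n. (1 / real n) *\<^sub>R (\<Sum>k<n. ?f (real k / real n))) \<longlonglongrightarrow> integral {0..1} ?f"
    by (intro riemann_sum_tendsto continuous_intros cont)
  also have "integral {0..1} ?f = cis (- z * b 0) * path_ft b a z"
    unfolding path_ft_def
    by (subst integral_mult_right[symmetric]) (auto intro!: Henstock_Kurzweil_Integration.integral_cong simp: cis_mult algebra_simps)
  finally have "(\<lambda>n. cmod ((of_nat n * (1 - exp (w / of_nat n))) * ((1 / real n) *\<^sub>R (\<Sum>k<n. ?f (real k / real n)))))
    \<longlonglongrightarrow> cmod (- w * (cis (- z * b 0) * path_ft b a z))"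
    by (intro tendsto_intros exp_divide_n_tendsto)
  moreover have "\<forall>\<^sub>F n in sequentially. cmod ((of_nat n * (1 - exp (w / of_nat n))) * ((1 / real n) *\<^sub>R (\<Sum>k<n. ?f (real k / real n))))
     = cmod (path_sum b a z n)"
    by (intro eventually_sequentiallyI[of 1]) (auto simp: path_sum_def w_def norm_mult)
  ultimately have "(\<lambda>n. cmod (path_sum b a z n)) \<longlonglongrightarrow> cmod (- w * (cis (- z * b 0) * path_ft b a z))"
    by (rule Lim_transform_eventually)
  then show ?thesis unfolding norm_mult norm_minus_cancel w_def by simp
qed

section \<open>From grid frequencies to all frequencies\<close>

lemma cmod_path_ft_le_1:
  assumes "continuous_on {0..1} b"
  shows "cmod (path_ft b a z) \<le> 1"
proof -
  have "norm (integral {0..1} (\<lambda>t. cis (a * t + z * b t))) \<le> 1 * (1 - 0)"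
    by (intro integral_bound continuous_intros assms) auto
  then show ?thesis by (simp add: path_ft_def)
qed

lemma cmod_cis_diff_le: "cmod (cis x - cis y) \<le> \<bar>x - y\<bar>"
proof -
  have "cis x - cis y = cis y * (cis (x - y) - 1)" by (simp add: cis_mult algebra_simps)
  then have "cmod (cis x - cis y) = cmod (cis (x - y) - 1)" by (simp add: norm_mult)
  also have "\<dots> \<le> \<bar>x - y\<bar>" using iexp_approx1[of "x - y" 0] by (simp add: cis_conv_exp)
  finally show ?thesis .
qed

lemma path_ft_lipschitz:
  assumes cont: "continuous_on {0..1} b" and K: "\<And>t. t \<in> {0..1} \<Longrightarrow> \<bar>b t\<bar> \<le> K"
  shows "cmod (path_ft b a z - path_ft b a' z') \<le> \<bar>a - a'\<bar> + K * \<bar>z - z'\<bar>"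
proof -
  have "path_ft b a z - path_ft b a' z' = integral {0..1} (\<lambda>t. cis (a * t + z * b t) - cis (a' * t + z' * b t))"
    unfolding path_ft_def
    by (subst Henstock_Kurzweil_Integration.integral_diff)
       (auto intro!: integrable_continuous_interval continuous_intros cont)
  also have "norm \<dots> \<le> (\<bar>a - a'\<bar> + K * \<bar>z - z'\<bar>) * (1 - 0)"
  proof (intro integral_bound continuous_intros cont)
    fix t :: real assume t: "t \<in> {0..1}"
    have "cmod (cis (a * t + z * b t) - cis (a' * t + z' * b t)) \<le> \<bar>(a * t + z * b t) - (a' * t + z' * b t)\<bar>"
      by (rule cmod_cis_diff_le)
    also have "\<dots> = \<bar>(a - a') * t + (z - z') * b t\<bar>" by (simp add: algebra_simps)
    also have "\<dots> \<le> \<bar>a - a'\<bar> * \<bar>t\<bar> + \<bar>z - z'\<bar> * \<bar>b t\<bar>"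
      by (metis abs_mult abs_triangle_ineq)
    also have "\<dots> \<le> \<bar>a - a'\<bar> * 1 + \<bar>z - z'\<bar> * K"
      using t K[OF t] by (intro add_mono mult_left_mono) auto
    finally show "cmod (cis (a * t + z * b t) - cis (a' * t + z' * b t)) \<le> \<bar>a - a'\<bar> + K * \<bar>z - z'\<bar>"
      by (simp add: mult.commute)
  qed auto
  finally show ?thesis by simp
qed

text \<open>The level-q grid has spacing q^(-2) and fills the square of half-side q. At (a, z) take
  q comparable to 1 + max |a| |z| and move to a nearby grid point. The Lipschitz error is O(q^(-2)),
  and the weight 1 + z^2 + |a| is at most 3 q^2, so the loss is bounded. At the grid point the
  logarithm of the hypothesis bounds the weighted transform by (1 + |z|) times ln T + 8 ln q, up to
  a constant.\<close>

lemma path_ft_decay_of_grid: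
  assumes cont: "continuous_on {0..1} b" and T: "T \<ge> 1"
    and grid: "\<And>(q::nat) (i::int) (j::int). q \<ge> 1 \<Longrightarrow> \<bar>i\<bar> \<le> int q ^ 3 \<Longrightarrow> \<bar>j\<bar> \<le> int q ^ 3 \<Longrightarrow>
      exp (cmod (\<i> * of_real (i / real q ^ 2) - of_real ((j / real q ^ 2)\<^sup>2 / 2)) *
        cmod (path_ft b (i / real q ^ 2) (j / real q ^ 2)) / (4 * (1 + \<bar>j / real q ^ 2\<bar>))) \<le> T * real q ^ 8"
  obtains C where "C \<ge> 0"
    "\<And>a z. cmod (path_ft b a z) * (1 + z\<^sup>2 + \<bar>a\<bar>) \<le> C * (1 + \<bar>z\<bar>) * (1 + ln (3 + \<bar>a\<bar> + \<bar>z\<bar>))"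
proof -
  have "bounded (b ` {0..1})"
    using compact_continuous_image[OF cont] by (simp add: compact_imp_bounded)
  then obtain K where K: "K > 0" "\<And>t. t \<in> {0..1} \<Longrightarrow> \<bar>b t\<bar> \<le> K"
    unfolding bounded_pos by auto
  \<comment> \<open>The terms are the Lipschitz error, the trivial bound \<open>F' \<le> 1\<close>
    with weight 4, and the grid bound with 128 = 16 * 8.\<close>
  define C where "C = 3 * (1 + K) + 4 + 128 * (ln T + 8)"
  have lnT: "ln T \<ge> 0" using T by simp
  \<comment> \<open>The margin \<open>q - 1\<close> leaves room for the rounding by the floor: (q -
    1) q^2 \<le> q^3 - 1.\<close>
  have near: "\<exists>i::int. \<bar>i\<bar> \<le> int q ^ 3 \<and> \<bar>x - i / real q ^ 2\<bar> \<le> 1 / real q ^ 2"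
    if q: "q \<ge> 1" "\<bar>x\<bar> \<le> real q - 1" for q :: nat and x :: real
  proof (intro exI conjI)
    let ?i = "\<lfloor>x * real q ^ 2\<rfloor>"
    have q2: "real q ^ 2 \<ge> 1" using q by simp
    have "\<bar>x * real q ^ 2\<bar> \<le> (real q - 1) * real q ^ 2"
      using q unfolding abs_mult by (intro mult_mono) auto
    also have "\<dots> \<le> real q ^ 3 - 1" using q2 by (simp add: algebra_simps eval_nat_numeral)
    finally have "\<bar>real_of_int ?i\<bar> \<le> real q ^ 3" by linarith
    then show "\<bar>?i\<bar> \<le> int q ^ 3" by (metis of_int_abs of_int_le_iff of_int_of_nat_eq of_int_power)
    have "x - ?i / real q ^ 2 = (x * real q ^ 2 - ?i) / real q ^ 2" using q by (simp add: diff_divide_distrib)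
    moreover have "\<bar>x * real q ^ 2 - ?i\<bar> \<le> 1" by linarith
    ultimately show "\<bar>x - ?i / real q ^ 2\<bar> \<le> 1 / real q ^ 2" using q2 by (simp add: divide_right_mono)
  qed
  show thesis
  proof (rule that[of C])
    show "C \<ge> 0" using K lnT by (simp add: C_def)
    fix a z :: real
    define L where "L = ln (3 + \<bar>a\<bar> + \<bar>z\<bar>)"
    define q where "q = nat \<lceil>max \<bar>a\<bar> \<bar>z\<bar>\<rceil> + 1"
    have q: "q \<ge> 1" "\<bar>a\<bar> \<le> real q - 1" "\<bar>z\<bar> \<le> real q - 1" "real q \<le> 3 + \<bar>a\<bar> + \<bar>z\<bar>"
      unfolding q_def by linarith+
    have L: "L \<ge> 0" "ln (real q) \<le> L" using q by (auto simp: L_def)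
    obtain i :: int where i: "\<bar>i\<bar> \<le> int q ^ 3" "\<bar>a - i / real q ^ 2\<bar> \<le> 1 / real q ^ 2" using near q by blast
    obtain j :: int where j: "\<bar>j\<bar> \<le> int q ^ 3" "\<bar>z - j / real q ^ 2\<bar> \<le> 1 / real q ^ 2" using near q by blast
    define a' where "a' = i / real q ^ 2"
    define z' where "z' = j / real q ^ 2"
    define F where "F = cmod (path_ft b a z)"
    define F' where "F' = cmod (path_ft b a' z')"
    define W where "W = cmod (\<i> * of_real a' - of_real (z'\<^sup>2 / 2))"
    have q2: "real q ^ 2 \<ge> 1" using q by simp
    have "1 / real q ^ 2 \<le> 1" using q2 q by (subst divide_le_eq_1_pos) auto
    then have az: "\<bar>a - a'\<bar> \<le> 1" "\<bar>z - z'\<bar> \<le> 1" using i j by (auto simp: a'_def z'_def)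
    have F': "0 \<le> F'" "F' \<le> 1" using cmod_path_ft_le_1[OF cont] by (auto simp: F'_def)
    \<comment> \<open>The real part gives z'^2/2 \<le> W and the imaginary part |a'| \<le>
      W.\<close>
    have W: "z'\<^sup>2 + \<bar>a'\<bar> \<le> 4 * W"
      using abs_Re_le_cmod[of "\<i> * of_real a' - of_real (z'\<^sup>2 / 2)"] abs_Im_le_cmod[of "\<i> * of_real a' - of_real (z'\<^sup>2 / 2)"]
      by (simp add: W_def)
    have "exp (W * F' / (4 * (1 + \<bar>z'\<bar>))) \<le> T * real q ^ 8"
      using grid[OF q(1) i(1) j(1)] unfolding W_def F'_def a'_def z'_def .
    then have "W * F' / (4 * (1 + \<bar>z'\<bar>)) \<le> ln (T * real q ^ 8)"
      using T q by (subst ln_ge_iff) auto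
    also have "\<dots> = ln T + 8 * ln (real q)" using T q by (simp add: ln_mult ln_realpow)
    also have "\<dots> \<le> (ln T + 8) * (1 + L)" using mult_nonneg_nonneg[OF L(1) lnT] L by (simp add: algebra_simps)
    finally have "W * F' \<le> 4 * (1 + \<bar>z'\<bar>) * ((ln T + 8) * (1 + L))" by (simp add: field_simps)
    also have "\<dots> \<le> 4 * (2 * (1 + \<bar>z\<bar>)) * ((ln T + 8) * (1 + L))"
      using az lnT L by (intro mult_right_mono mult_left_mono) auto
    also have "\<dots> = 8 * ((1 + \<bar>z\<bar>) * ((ln T + 8) * (1 + L)))" by (simp add: algebra_simps)
    finally have WF: "W * F' \<le> 8 * ((1 + \<bar>z\<bar>) * ((ln T + 8) * (1 + L)))" .
    have "z\<^sup>2 = (z' + (z - z'))\<^sup>2" by simp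
    also have "\<dots> \<le> 2 * z'\<^sup>2 + 2 * (z - z')\<^sup>2"
      using sum_squares_ge_zero[of "z' - (z - z')" 0] by (simp add: power2_eq_square algebra_simps)
    also have "(z - z')\<^sup>2 \<le> 1" using az by (simp add: abs_square_le_1)
    finally have "z\<^sup>2 \<le> 2 * z'\<^sup>2 + 2" by simp
    then have nrm: "1 + z\<^sup>2 + \<bar>a\<bar> \<le> 4 * (1 + (z'\<^sup>2 + \<bar>a'\<bar>))"
      using az zero_le_power2[of z'] by (smt (verit))
    have "z\<^sup>2 \<le> real q ^ 2" using power_mono[of "\<bar>z\<bar>" "real q" 2] q by simp
    moreover have "\<bar>a\<bar> \<le> real q ^ 2" using q(2) self_le_power[of "real q" 2] q(1) by linarith
    ultimately have nrm3: "1 + z\<^sup>2 + \<bar>a\<bar> \<le> 3 * real q ^ 2" using q2 by simp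
    have "F \<le> F' + cmod (path_ft b a z - path_ft b a' z')"
      unfolding F_def F'_def by (metis add.commute diff_le_eq norm_triangle_ineq2)
    also have "cmod (path_ft b a z - path_ft b a' z') \<le> \<bar>a - a'\<bar> + K * \<bar>z - z'\<bar>"
      by (rule path_ft_lipschitz[OF cont K(2)])
    also have "\<dots> \<le> 1 / real q ^ 2 + K * (1 / real q ^ 2)"
      using i j K by (intro add_mono mult_left_mono) (auto simp: a'_def z'_def)
    finally have "F \<le> F' + (1 + K) / real q ^ 2" by (simp add: add_divide_distrib)
    then have "F * (1 + z\<^sup>2 + \<bar>a\<bar>) \<le> (F' + (1 + K) / real q ^ 2) * (1 + z\<^sup>2 + \<bar>a\<bar>)"
      by (intro mult_right_mono) auto
    also have "\<dots> = F' * (1 + z\<^sup>2 + \<bar>a\<bar>) + (1 + K) / real q ^ 2 * (1 + z\<^sup>2 + \<bar>a\<bar>)" by (simp add: algebra_simps)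
    also have "\<dots> \<le> F' * (4 * (1 + (z'\<^sup>2 + \<bar>a'\<bar>))) + (1 + K) / real q ^ 2 * (3 * real q ^ 2)"
      using F' K nrm nrm3 by (intro add_mono mult_left_mono) auto
    also have "(1 + K) / real q ^ 2 * (3 * real q ^ 2) = 3 * (1 + K)" using q by simp
    also have "F' * (4 * (1 + (z'\<^sup>2 + \<bar>a'\<bar>))) \<le> F' * (4 * (1 + 4 * W))"
      using F' W by (intro mult_left_mono) auto
    also have "\<dots> = 4 * F' + 16 * (W * F')" by (simp add: algebra_simps)
    also have "\<dots> \<le> 4 * 1 + 16 * (8 * ((1 + \<bar>z\<bar>) * ((ln T + 8) * (1 + L))))"
      using F' WF by (intro add_mono mult_left_mono) auto
    finally have "F * (1 + z\<^sup>2 + \<bar>a\<bar>) \<le> (3 * (1 + K) + 4) * 1 + 128 * (ln T + 8) * ((1 + \<bar>z\<bar>) * (1 + L))"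
      by (simp add: algebra_simps)
    also have "\<dots> \<le> (3 * (1 + K) + 4) * ((1 + \<bar>z\<bar>) * (1 + L)) + 128 * (ln T + 8) * ((1 + \<bar>z\<bar>) * (1 + L))"
      using K L lnT mult_mono[of 1 "1 + \<bar>z\<bar>" 1 "1 + L"] by (intro add_mono mult_left_mono) auto
    also have "\<dots> = C * (1 + \<bar>z\<bar>) * (1 + L)" by (simp add: C_def algebra_simps)
    finally show "cmod (path_ft b a z) * (1 + z\<^sup>2 + \<bar>a\<bar>) \<le> C * (1 + \<bar>z\<bar>) * (1 + ln (3 + \<bar>a\<bar> + \<bar>z\<bar>))"
      by (simp add: F_def L_def)
  qed
qed

section \<open>Almost sure bounds, simultaneous in all frequencies\<close>

context standard_brownian_motion
begin

text \<open>A first-moment argument: the level-q grid has at most 9 q^6 points, each of expectation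
  at most 4 exp 2, so dividing the sum over the grid by q^8 leaves 36 exp 2 / q^2. This is summable
  over q, hence the total over all levels is almost surely finite and bounds each single
  term.\<close>

lemma AE_exp_liminf_grid:
  "AE \<omega> in M. \<exists>T\<ge>1. \<forall>q\<ge>1. \<forall>i j::int. \<bar>i\<bar> \<le> int q ^ 3 \<longrightarrow> \<bar>j\<bar> \<le> int q ^ 3 \<longrightarrow>
      exp_liminf (i / real q ^ 2) (j / real q ^ 2) \<omega> \<le> ennreal (T * real q ^ 8)"
proof -
  define G where "G q = {- (int q ^ 3)..int q ^ 3} \<times> {- (int q ^ 3)..int q ^ 3}" for q :: nat
  define h where "h m \<omega> = ennreal (1 / real (Suc m) ^ 8) *
      (\<Sum>p\<in>G (Suc m). exp_liminf (fst p / real (Suc m) ^ 2) (snd p / real (Suc m) ^ 2) \<omega>)" for m \<omega>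
  have [measurable]: "h m \<in> borel_measurable M" for m
    unfolding h_def by measurable
  have card: "real (card (G q)) \<le> 9 * real q ^ 6" if "q \<ge> 1" for q
  proof -
    have "card (G q) = (2 * q ^ 3 + 1) * (2 * q ^ 3 + 1)"
      unfolding G_def card_cartesian_product by (simp add: nat_add_distrib nat_mult_distrib nat_power_eq)
    then have "real (card (G q)) = (2 * real q ^ 3 + 1) * (2 * real q ^ 3 + 1)"
      by (simp only: of_nat_mult of_nat_add of_nat_power of_nat_numeral of_nat_1)
    also have "\<dots> \<le> (3 * real q ^ 3) * (3 * real q ^ 3)" using that by (intro mult_mono) auto
    finally show ?thesis by (simp add: power_add[symmetric])
  qed
  have h: "(\<integral>\<^sup>+\<omega>. h m \<omega> \<partial>M) \<le> ennreal (36 * exp 2 * (1 / real (Suc m) ^ 2))" for m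
  proof -
    have "(\<integral>\<^sup>+\<omega>. h m \<omega> \<partial>M) = ennreal (1 / real (Suc m) ^ 8) *
       (\<Sum>p\<in>G (Suc m). \<integral>\<^sup>+\<omega>. exp_liminf (fst p / real (Suc m) ^ 2) (snd p / real (Suc m) ^ 2) \<omega> \<partial>M)"
      unfolding h_def by (subst nn_integral_cmult) (auto simp: nn_integral_sum)
    also have "\<dots> \<le> ennreal (1 / real (Suc m) ^ 8) * (\<Sum>p\<in>G (Suc m). ennreal (4 * exp 2))"
      by (intro mult_left_mono sum_mono nn_integral_exp_liminf_le) auto
    also have "\<dots> = ennreal (1 / real (Suc m) ^ 8 * (card (G (Suc m)) * (4 * exp 2)))"
      by (simp only: sum_constant ennreal_of_nat_eq_real_of_nat ennreal_mult'[symmetric]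
            of_nat_0_le_iff zero_le_divide_1_iff zero_le_power)
    also have "\<dots> \<le> ennreal (1 / real (Suc m) ^ 8 * ((9 * real (Suc m) ^ 6) * (4 * exp 2)))"
      by (intro ennreal_leI mult_left_mono mult_right_mono card) auto
    also have "1 / real (Suc m) ^ 8 * ((9 * real (Suc m) ^ 6) * (4 * exp 2)) = 36 * exp 2 * (1 / real (Suc m) ^ 2)"
      by (simp add: field_simps power_add[symmetric])
    finally show ?thesis .
  qed
  have "summable (\<lambda>m. 36 * exp 2 * (1 / real (Suc m) ^ 2))"
    using inverse_power_summable[of 2, where 'a = real]
    by (intro summable_mult) (subst summable_Suc_iff, simp add: inverse_eq_divide)
  then have fin: "(\<Sum>m. ennreal (36 * exp 2 * (1 / real (Suc m) ^ 2))) \<noteq> \<infinity>"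
    by (subst suminf_ennreal2) auto
  have "(\<integral>\<^sup>+\<omega>. (\<Sum>m. h m \<omega>) \<partial>M) = (\<Sum>m. \<integral>\<^sup>+\<omega>. h m \<omega> \<partial>M)"
    by (intro nn_integral_suminf) simp
  also have "\<dots> \<le> (\<Sum>m. ennreal (36 * exp 2 * (1 / real (Suc m) ^ 2)))"
    by (intro suminf_le h) auto
  finally have "(\<integral>\<^sup>+\<omega>. (\<Sum>m. h m \<omega>) \<partial>M) \<noteq> \<infinity>" using fin by (auto simp: top_unique)
  then have "AE \<omega> in M. (\<Sum>m. h m \<omega>) \<noteq> \<infinity>"
    by (intro nn_integral_noteq_infinite) auto
  then show ?thesis
  proof (eventually_elim)
    case (elim \<omega>)
    then obtain T0 where T0: "T0 \<ge> 0" "(\<Sum>m. h m \<omega>) = ennreal T0" by (cases "\<Sum>m. h m \<omega>") auto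
    \<comment> \<open>Adding 1 to the total \<open>T0\<close> ensures that the constant is at least
      1.\<close>
    have "exp_liminf (i / real q ^ 2) (j / real q ^ 2) \<omega> \<le> ennreal ((T0 + 1) * real q ^ 8)"
      if q: "q \<ge> 1" and ij: "\<bar>i\<bar> \<le> int q ^ 3" "\<bar>j\<bar> \<le> int q ^ 3" for q and i j :: int
    proof -
      obtain m where m: "q = Suc m" using q by (cases q) auto
      let ?e = "exp_liminf (i / real q ^ 2) (j / real q ^ 2) \<omega>"
      have "?e \<le> (\<Sum>p\<in>G q. exp_liminf (fst p / real q ^ 2) (snd p / real q ^ 2) \<omega>)"
        using member_le_sum[of "(i, j)" "G q" "\<lambda>p. exp_liminf (real_of_int (fst p) / real q ^ 2) (real_of_int (snd p) / real q ^ 2) \<omega>"] ij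
        by (auto simp: G_def abs_le_iff)
      then have "ennreal (1 / real q ^ 8) * ?e \<le> h m \<omega>" unfolding h_def m by (intro mult_left_mono) auto
      also have "\<dots> \<le> (\<Sum>m. h m \<omega>)" using sum_le_suminf[of "\<lambda>m. h m \<omega>" "{m}"] by simp
      finally have *: "ennreal (1 / real q ^ 8) * ?e \<le> ennreal T0" by (simp add: T0)
      have "?e = ennreal (real q ^ 8) * (ennreal (1 / real q ^ 8) * ?e)"
        using q by (simp add: mult.assoc[symmetric] ennreal_mult[symmetric])
      also have "\<dots> \<le> ennreal (real q ^ 8) * ennreal (T0 + 1)"
        using T0 by (intro mult_left_mono order_trans[OF *] ennreal_leI) auto
      finally show ?thesis using T0 by (simp add: ennreal_mult[symmetric] mult.commute del: ennreal_plus)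
    qed
    with T0(1) show ?case by (intro exI[of _ "T0 + 1"]) auto
  qed
qed

text \<open>The exceptional null set is the same for all frequencies: the grids are countable and
  the passage from them to general frequencies is deterministic. Continuity of the path turns the
  lower limit into the exponential of the path integral.\<close>

lemma AE_path_ft_decay:
  "AE \<omega> in M. \<exists>C\<ge>0. \<forall>a z. cmod (path_ft (\<lambda>t. B t \<omega>) a z) * (1 + z\<^sup>2 + \<bar>a\<bar>) \<le>
      C * (1 + \<bar>z\<bar>) * (1 + ln (3 + \<bar>a\<bar> + \<bar>z\<bar>))"
  using AE_exp_liminf_grid continuous_paths
proof eventually_elim
  case (elim \<omega>)
  then obtain T where T: "T \<ge> 1" "\<And>q (i::int) (j::int). q \<ge> 1 \<Longrightarrow> \<bar>i\<bar> \<le> int q ^ 3 \<Longrightarrow> \<bar>j\<bar> \<le> int q ^ 3 \<Longrightarrow>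
      exp_liminf (i / real q ^ 2) (j / real q ^ 2) \<omega> \<le> ennreal (T * real q ^ 8)" by blast
  have lim: "exp_liminf a z \<omega> = ennreal (exp (cmod (\<i> * of_real a - of_real (z\<^sup>2 / 2)) *
      cmod (path_ft (\<lambda>t. B t \<omega>) a z) / (4 * (1 + \<bar>z\<bar>))))" for a z
    unfolding exp_liminf_def
    by (intro lim_imp_Liminf tendsto_ennrealI tendsto_intros cmod_path_sum_tendsto elim(2)) (auto simp: add_nonneg_eq_0_iff)
  show ?case
    by (rule path_ft_decay_of_grid[OF elim(2) T(1)]) (use T in \<open>auto simp: lim ennreal_le_iff\<close>)
qed

end

section \<open>The additive sheet\<close>

text \<open>Absorbs a logarithm into an arbitrarily small power, by ln x \<le> x^e / e.\<close>

lemma one_plus_ln_le_powr: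
  fixes e :: real
  assumes "e > 0"
  obtains K :: real where "K > 0" "\<And>R. R \<ge> 0 \<Longrightarrow> 1 + ln (3 + R) \<le> K * (1 + R) powr e"
proof (rule that[of "1 + 3 powr e / e"])
  fix R :: real assume R: "R \<ge> 0"
  have "ln (3 + R) \<le> (3 + R) powr e / e" using R assms by (intro ln_powr_bound) auto
  also have "\<dots> \<le> (3 * (1 + R)) powr e / e"
    using R assms by (intro divide_right_mono powr_mono2) auto
  also have "\<dots> = 3 powr e / e * (1 + R) powr e" using R by (subst powr_mult) auto
  finally show "1 + ln (3 + R) \<le> (1 + 3 powr e / e) * (1 + R) powr e"
    using ge_one_powr_ge_zero[of "1 + R" e] R assms by (simp add: distrib_right)
qed (use assms in \<open>auto simp: add_pos_nonneg\<close>)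

text \<open>Since z is shared, (1 + z^2 + |a1|)(1 + z^2 + |a2|) \<ge> (1 + z^2)(1 + z^2 + |a1| +
  |a2|), while the two numerators contribute (1 + |z|)^2 \<le> 2 (1 + z^2). The factor 1 + z^2
  cancels, and what is left of the denominator is at least (1 + R)/2.\<close>

lemma product_decay:
  fixes F1 F2 a1 a2 z C1 C2 :: real
  assumes "F1 \<ge> 0" "F2 \<ge> 0" "C1 \<ge> 0" "C2 \<ge> 0"
    and F1: "F1 * (1 + z\<^sup>2 + \<bar>a1\<bar>) \<le> C1 * (1 + \<bar>z\<bar>) * (1 + ln (3 + \<bar>a1\<bar> + \<bar>z\<bar>))"
    and F2: "F2 * (1 + z\<^sup>2 + \<bar>a2\<bar>) \<le> C2 * (1 + \<bar>z\<bar>) * (1 + ln (3 + \<bar>a2\<bar> + \<bar>z\<bar>))"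
  defines "R \<equiv> \<bar>a1\<bar> + \<bar>a2\<bar> + \<bar>z\<bar>"
  shows "F1 * F2 * (1 + R) \<le> 4 * C1 * C2 * (1 + ln (3 + R))\<^sup>2"
proof -
  define l where "l = ln (3 + R)"
  have l: "l \<ge> 0" "ln (3 + \<bar>a1\<bar> + \<bar>z\<bar>) \<le> l" "ln (3 + \<bar>a2\<bar> + \<bar>z\<bar>) \<le> l"
    by (auto simp: l_def R_def)
  have z: "1 + z\<^sup>2 > 0" by (simp add: add_pos_nonneg)
  have "0 \<le> (1 - \<bar>z\<bar>)\<^sup>2" by simp
  then have z1: "(1 + \<bar>z\<bar>)\<^sup>2 \<le> 2 * (1 + z\<^sup>2)" by (simp add: power2_eq_square algebra_simps)
  have "F1 * (1 + z\<^sup>2 + \<bar>a1\<bar>) \<le> C1 * (1 + \<bar>z\<bar>) * (1 + l)"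
    using assms l by (intro order_trans[OF F1] mult_left_mono) auto
  moreover have "F2 * (1 + z\<^sup>2 + \<bar>a2\<bar>) \<le> C2 * (1 + \<bar>z\<bar>) * (1 + l)"
    using assms l by (intro order_trans[OF F2] mult_left_mono) auto
  ultimately have "(F1 * (1 + z\<^sup>2 + \<bar>a1\<bar>)) * (F2 * (1 + z\<^sup>2 + \<bar>a2\<bar>)) \<le> (C1 * (1 + \<bar>z\<bar>) * (1 + l)) * (C2 * (1 + \<bar>z\<bar>) * (1 + l))"
    by (rule mult_mono) (use assms(1-4) l in \<open>auto simp: add_nonneg_nonneg\<close>)
  also have "\<dots> = C1 * C2 * (1 + l)\<^sup>2 * (1 + \<bar>z\<bar>)\<^sup>2" by (simp add: power2_eq_square mult_ac)
  also have "\<dots> \<le> C1 * C2 * (1 + l)\<^sup>2 * (2 * (1 + z\<^sup>2))"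
    using assms z1 by (intro mult_left_mono) auto
  also have "\<dots> = (1 + z\<^sup>2) * (2 * (C1 * C2 * (1 + l)\<^sup>2))" by (simp add: algebra_simps)
  finally have 1: "(F1 * (1 + z\<^sup>2 + \<bar>a1\<bar>)) * (F2 * (1 + z\<^sup>2 + \<bar>a2\<bar>)) \<le> (1 + z\<^sup>2) * (2 * (C1 * C2 * (1 + l)\<^sup>2))" .
  have "(1 + z\<^sup>2) * (F1 * F2 * (1 + z\<^sup>2 + \<bar>a1\<bar> + \<bar>a2\<bar>)) + F1 * F2 * (\<bar>a1\<bar> * \<bar>a2\<bar>)
      = (F1 * (1 + z\<^sup>2 + \<bar>a1\<bar>)) * (F2 * (1 + z\<^sup>2 + \<bar>a2\<bar>))"
    by (simp add: algebra_simps)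
  moreover have "F1 * F2 * (\<bar>a1\<bar> * \<bar>a2\<bar>) \<ge> 0" using assms by simp
  ultimately have "(1 + z\<^sup>2) * (F1 * F2 * (1 + z\<^sup>2 + \<bar>a1\<bar> + \<bar>a2\<bar>)) \<le> (1 + z\<^sup>2) * (2 * (C1 * C2 * (1 + l)\<^sup>2))"
    using 1 by linarith
  then have 2: "F1 * F2 * (1 + z\<^sup>2 + \<bar>a1\<bar> + \<bar>a2\<bar>) \<le> 2 * (C1 * C2 * (1 + l)\<^sup>2)"
    by (rule mult_left_le_imp_le) (rule z)
  have "\<bar>z\<bar> \<le> 1 + z\<^sup>2" using sum_squares_ge_zero[of "\<bar>z\<bar> - 1" 0] z by (simp add: power2_eq_square algebra_simps)
  then have "1 + R \<le> 2 * (1 + z\<^sup>2 + \<bar>a1\<bar> + \<bar>a2\<bar>)"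
    unfolding R_def using zero_le_power2[of z] by (smt (verit))
  then have "F1 * F2 * (1 + R) \<le> F1 * F2 * (2 * (1 + z\<^sup>2 + \<bar>a1\<bar> + \<bar>a2\<bar>))"
    using assms by (intro mult_left_mono) auto
  also have "\<dots> = 2 * (F1 * F2 * (1 + z\<^sup>2 + \<bar>a1\<bar> + \<bar>a2\<bar>))" by simp
  also have "\<dots> \<le> 2 * (2 * (C1 * C2 * (1 + l)\<^sup>2))" using 2 by (rule mult_left_mono) simp
  finally show ?thesis by (simp add: l_def mult_ac)
qed

section \<open>The push-forward of Lebesgue measure on the square\<close>

definition unit_uniform :: "real measure" where
  "unit_uniform = density lborel (\<lambda>x. ennreal (indicator {0..1} x))"

lemma sets_unit_uniform [simp, measurable_cong]: "sets unit_uniform = sets borel"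
  by (simp add: unit_uniform_def)

lemma prob_space_unit_uniform: "prob_space unit_uniform"
  by (rule prob_spaceI) (simp add: unit_uniform_def emeasure_density ennreal_indicator)

lemma AE_unit_uniform: "AE x in unit_uniform. x \<in> {0..1}"
  unfolding unit_uniform_def by (subst AE_density) (auto simp: indicator_def)

lemma integral_unit_uniform:
  fixes f :: "real \<Rightarrow> complex"
  assumes "continuous_on UNIV f"
  shows "(LINT x|unit_uniform. f x) = integral {0..1} f"
proof -
  have "(LINT x|unit_uniform. f x) = (LINT x:{0..1}|lborel. f x)"
    unfolding unit_uniform_def set_lebesgue_integral_def
    using borel_measurable_continuous_onI[OF assms] by (subst integral_density) auto
  also have "\<dots> = integral {0..1} f"
    by (intro set_borel_integral_eq_integral borel_integrable_atLeastAtMost' continuous_on_subset[OF assms]) auto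
  finally show ?thesis .
qed

text \<open>Push the uniform measure on the square forward to the graph. Additivity splits the phase
  into a function of the first time plus a function of the second, with the same value frequency in
  both, so the transform factors by Fubini.\<close>

lemma additive_graph_measure:
  fixes b1 b2 :: "real \<Rightarrow> real"
  assumes cont: "continuous_on {0..1} b1" "continuous_on {0..1} b2"
  obtains \<mu> :: "((real \<times> real) \<times> real) measure" where "sets \<mu> = sets borel" "prob_space \<mu>"
    "AE x in \<mu>. x \<in> {(t, b1 (fst t) + b2 (snd t)) | t. t \<in> {0..1} \<times> {0..1}}"
    "\<And>\<xi>. fourier_transform \<mu> \<xi> =
      path_ft b1 (- 2 * pi * fst (fst \<xi>)) (- 2 * pi * snd \<xi>) * path_ft b2 (- 2 * pi * snd (fst \<xi>)) (- 2 * pi * snd \<xi>)"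
proof -
  \<comment> \<open>Clamping to the unit interval extends the paths continuously to the real line,
    on which \<open>unit_uniform\<close> is defined; almost every point is unaffected.\<close>
  define cl where "cl t = max 0 (min 1 t)" for t :: real
  have cl: "cl t \<in> {0..1}" "t \<in> {0..1} \<Longrightarrow> cl t = t" for t by (auto simp: cl_def)
  have ccl: "continuous_on UNIV cl" unfolding cl_def by (intro continuous_intros)
  have cc: "continuous_on UNIV (\<lambda>t. b1 (cl t))" "continuous_on UNIV (\<lambda>t. b2 (cl t))"
    using cl by (auto intro!: continuous_on_compose2[OF cont(1) ccl] continuous_on_compose2[OF cont(2) ccl])
  define g where "g t = (t, b1 (cl (fst t)) + b2 (cl (snd t)))" for t
  have "continuous_on UNIV g"
    unfolding g_def
    by (intro continuous_intros continuous_on_compose2[OF cc(1)] continuous_on_compose2[OF cc(2)]) auto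
  then have "g \<in> borel_measurable borel" by (rule borel_measurable_continuous_onI)
  then have gm [measurable]: "g \<in> borel_measurable (unit_uniform \<Otimes>\<^sub>M unit_uniform)"
    using measurable_cong_sets[OF sets_pair_borel[OF sets_unit_uniform sets_unit_uniform] refl] by blast
  interpret U: prob_space unit_uniform by (rule prob_space_unit_uniform)
  interpret UU: pair_prob_space unit_uniform unit_uniform ..
  define \<mu> where "\<mu> = distr (unit_uniform \<Otimes>\<^sub>M unit_uniform) borel g"
  define G where "G = {(t, b1 (fst t) + b2 (snd t)) | t. t \<in> {0..1} \<times> {0..1}}"
  have "compact ((\<lambda>t. (t, b1 (fst t) + b2 (snd t))) ` ({0..1} \<times> {0..1}))"
    by (intro compact_continuous_image continuous_intros compact_Times compact_Icc
        continuous_on_compose2[OF cont(1)] continuous_on_compose2[OF cont(2)]) auto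
  also have "(\<lambda>t. (t, b1 (fst t) + b2 (snd t))) ` ({0..1} \<times> {0..1}) = G" by (auto simp: G_def)
  finally have [measurable]: "G \<in> sets borel" by (intro borel_compact)
  show thesis
  proof (rule that[of \<mu>])
    show "sets \<mu> = sets borel" by (simp add: \<mu>_def)
    show "prob_space \<mu>" unfolding \<mu>_def by (intro UU.prob_space_distr gm)
    have "AE t in unit_uniform \<Otimes>\<^sub>M unit_uniform. t \<in> {0..1} \<times> {0..1}"
    proof (rule UU.AE_pair_measure)
      show "AE x in unit_uniform. AE y in unit_uniform. (x, y) \<in> {0..1} \<times> {0..1}"
        using AE_unit_uniform
      proof eventually_elim
        case (elim x)
        show ?case using AE_unit_uniform by eventually_elim (use elim in auto)
      qed
    qed measurable
    then have "AE t in unit_uniform \<Otimes>\<^sub>M unit_uniform. g t \<in> G"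
      by eventually_elim (auto simp: g_def G_def cl(2))
    then show "AE x in \<mu>. x \<in> {(t, b1 (fst t) + b2 (snd t)) | t. t \<in> {0..1} \<times> {0..1}}"
      unfolding \<mu>_def G_def[symmetric] by (subst AE_distr_iff) auto
    fix \<xi> :: "(real \<times> real) \<times> real"
    define a1 a2 z where az: "a1 = - 2 * pi * fst (fst \<xi>)" "a2 = - 2 * pi * snd (fst \<xi>)" "z = - 2 * pi * snd \<xi>"
    have c1: "continuous_on UNIV (\<lambda>t. cis (a1 * t + z * b1 (cl t)))"
      and c2: "continuous_on UNIV (\<lambda>t. cis (a2 * t + z * b2 (cl t)))"
      by (intro continuous_intros cc)+
    have path: "(LINT t|unit_uniform. cis (a * t + z * b (cl t))) = path_ft b a z"
      if "continuous_on UNIV (\<lambda>t. cis (a * t + z * b (cl t)))" for a b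
      unfolding integral_unit_uniform[OF that] path_ft_def
      by (intro Henstock_Kurzweil_Integration.integral_cong) (simp add: cl(2))
    have int: "integrable unit_uniform (\<lambda>t. cis (a * t + z * b (cl t)))"
      if "continuous_on UNIV (\<lambda>t. cis (a * t + z * b (cl t)))" for a b
      by (rule U.integrable_const_bound[of _ 1]) (use borel_measurable_continuous_onI[OF that] in auto)
    have "fourier_transform \<mu> \<xi> = (LINT t|(unit_uniform \<Otimes>\<^sub>M unit_uniform). cis (((- 2 * pi) *\<^sub>R \<xi>) \<bullet> g t))"
      unfolding fourier_transform_conv_cis \<mu>_def by (intro integral_distr gm) measurable
    also have "\<dots> = (LINT t|(unit_uniform \<Otimes>\<^sub>M unit_uniform).
        cis (a1 * fst t + z * b1 (cl (fst t))) * cis (a2 * snd t + z * b2 (cl (snd t))))"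
      by (intro Bochner_Integration.integral_cong) (auto simp: g_def az inner_prod_def cis_mult algebra_simps)
    also have "\<dots> = (LINT t|unit_uniform. cis (a1 * t + z * b1 (cl t))) * (LINT t|unit_uniform. cis (a2 * t + z * b2 (cl t)))"
      by (intro integral_pair_mult[of _ _ "\<lambda>t. cis (a1 * t + z * b1 (cl t))" "\<lambda>t. cis (a2 * t + z * b2 (cl t))"]
          U.sigma_finite_measure_axioms int c1 c2)
    also have "\<dots> = path_ft b1 a1 z * path_ft b2 a2 z" by (simp only: path c1 c2)
    finally show "fourier_transform \<mu> \<xi> = path_ft b1 (- 2 * pi * fst (fst \<xi>)) (- 2 * pi * snd \<xi>) *
        path_ft b2 (- 2 * pi * snd (fst \<xi>)) (- 2 * pi * snd \<xi>)"
      unfolding az .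
  qed
qed

lemma norm_le_sum_coords: "norm \<xi> \<le> \<bar>fst (fst \<xi>)\<bar> + \<bar>snd (fst \<xi>)\<bar> + \<bar>snd \<xi>\<bar>" for \<xi> :: "(real \<times> real) \<times> real"
  using norm_prod_le[of \<xi>] norm_prod_le[of "fst \<xi>"] by simp

text \<open>The squared transform is bounded by a constant times (1 + R)^(-2) and the fourth power
  of a logarithmic factor. With e = (2 - s)/4 that fourth power costs at most a constant times (1 +
  R)^(4e), which is exactly the gap 2 - s; finally |\<xi>| \<le> R because 2 pi \<ge> 1.\<close>

lemma additive_graph_fourier_bounded:
  fixes \<mu> :: "((real \<times> real) \<times> real) measure"
  assumes ft: "\<And>\<xi>. fourier_transform \<mu> \<xi> =
      path_ft b1 (- 2 * pi * fst (fst \<xi>)) (- 2 * pi * snd \<xi>) * path_ft b2 (- 2 * pi * snd (fst \<xi>)) (- 2 * pi * snd \<xi>)"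
    and C: "C1 \<ge> 0" "C2 \<ge> 0"
    and b1: "\<And>a z. cmod (path_ft b1 a z) * (1 + z\<^sup>2 + \<bar>a\<bar>) \<le> C1 * (1 + \<bar>z\<bar>) * (1 + ln (3 + \<bar>a\<bar> + \<bar>z\<bar>))"
    and b2: "\<And>a z. cmod (path_ft b2 a z) * (1 + z\<^sup>2 + \<bar>a\<bar>) \<le> C2 * (1 + \<bar>z\<bar>) * (1 + ln (3 + \<bar>a\<bar> + \<bar>z\<bar>))"
    and s: "0 \<le> s" "s < 2"
  shows "bdd_above (range (\<lambda>\<xi>. (cmod (fourier_transform \<mu> \<xi>))\<^sup>2 * norm \<xi> powr s))"
proof -
  define e where "e = (2 - s) / 4"
  have e: "e > 0" "s = 2 - 4 * e" using s by (simp_all add: e_def field_simps)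
  obtain K where K: "K > 0" "\<And>R. R \<ge> 0 \<Longrightarrow> 1 + ln (3 + R) \<le> K * (1 + R) powr e"
    using one_plus_ln_le_powr[OF e(1)] by blast
  have "(cmod (fourier_transform \<mu> \<xi>))\<^sup>2 * norm \<xi> powr s \<le> (4 * C1 * C2)\<^sup>2 * K ^ 4" for \<xi>
  proof -
    define a1 a2 z where az: "a1 = - 2 * pi * fst (fst \<xi>)" "a2 = - 2 * pi * snd (fst \<xi>)" "z = - 2 * pi * snd \<xi>"
    define R where "R = \<bar>a1\<bar> + \<bar>a2\<bar> + \<bar>z\<bar>"
    define F where "F = cmod (path_ft b1 a1 z) * cmod (path_ft b2 a2 z)"
    have R: "R \<ge> 0" by (simp add: R_def)
    have "F * (1 + R) \<le> 4 * C1 * C2 * (1 + ln (3 + R))\<^sup>2"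
      unfolding F_def R_def by (rule product_decay) (use C b1 b2 in auto)
    also have "\<dots> \<le> 4 * C1 * C2 * (K * (1 + R) powr e)\<^sup>2"
      using C R by (intro mult_left_mono power_mono K) auto
    finally have "(F * (1 + R))\<^sup>2 \<le> (4 * C1 * C2 * (K * (1 + R) powr e)\<^sup>2)\<^sup>2"
      using R by (intro power_mono) (auto simp: F_def)
    also have "\<dots> = (4 * C1 * C2)\<^sup>2 * K ^ 4 * ((1 + R) powr e) ^ 4"
      by (simp add: power_mult_distrib flip: power_mult)
    also have "((1 + R) powr e) ^ 4 = (1 + R) powr (4 * e)"
      using R by (simp add: powr_power mult.commute)
    finally have main: "F\<^sup>2 * (1 + R)\<^sup>2 \<le> (4 * C1 * C2)\<^sup>2 * K ^ 4 * (1 + R) powr (4 * e)"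
      by (simp add: power_mult_distrib)
    have "norm \<xi> \<le> 2 * pi * (\<bar>fst (fst \<xi>)\<bar> + \<bar>snd (fst \<xi>)\<bar> + \<bar>snd \<xi>\<bar>)"
      using norm_le_sum_coords[of \<xi>] pi_ge_two
        mult_right_mono[of 1 "2 * pi" "\<bar>fst (fst \<xi>)\<bar> + \<bar>snd (fst \<xi>)\<bar> + \<bar>snd \<xi>\<bar>"] by simp
    also have "\<dots> = R" by (simp add: R_def az abs_mult algebra_simps)
    finally have "norm \<xi> powr s \<le> (1 + R) powr s" using s by (intro powr_mono2) auto
    also have "\<dots> = (1 + R)\<^sup>2 * (1 + R) powr (- (4 * e))"
      using R by (simp add: e(2) powr_diff powr_minus powr_numeral divide_inverse)
    finally have "F\<^sup>2 * norm \<xi> powr s \<le> F\<^sup>2 * ((1 + R)\<^sup>2 * (1 + R) powr (- (4 * e)))"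
      by (intro mult_left_mono) auto
    also have "\<dots> = F\<^sup>2 * (1 + R)\<^sup>2 * (1 + R) powr (- (4 * e))" by simp
    also have "\<dots> \<le> ((4 * C1 * C2)\<^sup>2 * K ^ 4 * (1 + R) powr (4 * e)) * (1 + R) powr (- (4 * e))"
      by (intro mult_right_mono main) auto
    also have "\<dots> = (4 * C1 * C2)\<^sup>2 * K ^ 4" using R by (simp add: mult.assoc powr_add[symmetric])
    finally show ?thesis unfolding ft norm_mult F_def az .
  qed
  then show ?thesis by (intro bdd_aboveI2)
qed

text \<open>One measure \<open>\<mu>\<close> makes every exponent in [0, 2) admissible, and no
  admissible exponent exceeds 2. The supremum is therefore 2 whether or not it is attained.\<close>

lemma fourier_dimension_eq_2:
  fixes X :: "((real \<times> real) \<times> real) set" and \<mu> :: "((real \<times> real) \<times> real) measure"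
  assumes le: "\<And>s \<mu> :: ((real \<times> real) \<times> real) measure. sets \<mu> = sets borel \<Longrightarrow> finite_measure \<mu> \<Longrightarrow> emeasure \<mu> UNIV \<noteq> 0 \<Longrightarrow>
      AE x in \<mu>. x \<in> X \<Longrightarrow> bdd_above (range (\<lambda>\<xi>. (cmod (fourier_transform \<mu> \<xi>))\<^sup>2 * norm \<xi> powr s)) \<Longrightarrow> s \<le> 2"
    and \<mu>: "sets \<mu> = sets borel" "prob_space \<mu>" "AE x in \<mu>. x \<in> X"
    and ge: "\<And>s. 0 \<le> s \<Longrightarrow> s < 2 \<Longrightarrow> bdd_above (range (\<lambda>\<xi>. (cmod (fourier_transform \<mu> \<xi>))\<^sup>2 * norm \<xi> powr s))"
  shows "fourier_dimension X = 2"
proof -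
  define S where "S = {s \<in> {0..real DIM((real \<times> real) \<times> real)}.
     \<exists>\<mu> :: ((real \<times> real) \<times> real) measure. sets \<mu> = sets borel \<and> finite_measure \<mu> \<and> emeasure \<mu> UNIV \<noteq> 0 \<and>
       (AE x in \<mu>. x \<in> X) \<and>
       bdd_above (range (\<lambda>\<xi>. (cmod (fourier_transform \<mu> \<xi>))\<^sup>2 * norm \<xi> powr s))}"
  interpret prob_space \<mu> by fact
  have "emeasure \<mu> UNIV \<noteq> 0"
    using emeasure_space_1 sets_eq_imp_space_eq[OF \<mu>(1)] by simp
  then have S1: "s \<in> S" if "0 \<le> s" "s < 2" for s
    using that \<mu> ge[OF that] finite_measure_axioms unfolding S_def by auto
  have S2: "s \<le> 2" if "s \<in> S" for s using that le unfolding S_def by blast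
  have "Sup S = 2"
  proof (rule antisym)
    show "Sup S \<le> 2" using S1[of 0] S2 by (intro cSup_least) auto
    have "bdd_above S" using S2 by (rule bdd_aboveI)
    then show "2 \<le> Sup S"
      by (intro dense_le_bounded[of 0 2] cSup_upper S1) auto
  qed
  then show ?thesis by (simp add: fourier_dimension_def S_def)
qed

theorem corollary2p2:
  fixes M :: "'w measure" and W :: "real \<times> real \<Rightarrow> 'w \<Rightarrow> real"
  assumes "additive_brownian_sheet_2_1 M W"
  shows "AE \<omega> in M. fourier_dimension (sheet_graph W \<omega>) = 2"
proof -
  obtain W1 W2 where W1: "standard_brownian_motion M W1" and W2: "standard_brownian_motion M W2"
    and W: "\<And>t1 t2 \<omega>. t1 \<in> {0..1} \<Longrightarrow> t2 \<in> {0..1} \<Longrightarrow> \<omega> \<in> space M \<Longrightarrow> W (t1, t2) \<omega> = W1 t1 \<omega> + W2 t2 \<omega>"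
    using assms unfolding additive_brownian_sheet_2_1_def by blast
  \<comment> \<open>Probability enters through these almost sure properties; afterwards the argument
    concerns one fixed outcome. \<open>AE_space\<close> is included because \<open>W\<close> is
    related to \<open>W1\<close> and \<open>W2\<close> only on \<open>space M\<close>.\<close>
  show ?thesis
    using standard_brownian_motion.continuous_paths[OF W1] standard_brownian_motion.continuous_paths[OF W2]
      standard_brownian_motion.AE_path_ft_decay[OF W1] standard_brownian_motion.AE_path_ft_decay[OF W2] AE_space
  proof eventually_elim
    case (elim \<omega>)
    define f where "f t = W1 (fst t) \<omega> + W2 (snd t) \<omega>" for t
    have graph: "sheet_graph W \<omega> = {(t, f t) | t. t \<in> {0..1} \<times> {0..1}}"
      unfolding sheet_graph_def f_def using elim(5) by (auto simp: W)
    have cf: "continuous_on ({0..1} \<times> {0..1}) f"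
      unfolding f_def
      by (intro continuous_intros continuous_on_compose2[OF elim(1)] continuous_on_compose2[OF elim(2)]) auto
    obtain C1 where C1: "C1 \<ge> 0" "\<And>a z. cmod (path_ft (\<lambda>t. W1 t \<omega>) a z) * (1 + z\<^sup>2 + \<bar>a\<bar>) \<le>
      C1 * (1 + \<bar>z\<bar>) * (1 + ln (3 + \<bar>a\<bar> + \<bar>z\<bar>))" using elim(3) by blast
    obtain C2 where C2: "C2 \<ge> 0" "\<And>a z. cmod (path_ft (\<lambda>t. W2 t \<omega>) a z) * (1 + z\<^sup>2 + \<bar>a\<bar>) \<le>
      C2 * (1 + \<bar>z\<bar>) * (1 + ln (3 + \<bar>a\<bar> + \<bar>z\<bar>))" using elim(4) by blast
    obtain \<mu> :: "((real \<times> real) \<times> real) measure" where \<mu>: "sets \<mu> = sets borel" "prob_space \<mu>"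
      "AE x in \<mu>. x \<in> {(t, W1 (fst t) \<omega> + W2 (snd t) \<omega>) | t. t \<in> {0..1} \<times> {0..1}}"
      "\<And>\<xi>. fourier_transform \<mu> \<xi> = path_ft (\<lambda>t. W1 t \<omega>) (- 2 * pi * fst (fst \<xi>)) (- 2 * pi * snd \<xi>) *
        path_ft (\<lambda>t. W2 t \<omega>) (- 2 * pi * snd (fst \<xi>)) (- 2 * pi * snd \<xi>)"
      by (rule additive_graph_measure[OF elim(1,2)]) blast
    show ?case
      unfolding graph
    proof (rule fourier_dimension_eq_2[OF _ \<mu>(1,2)])
      show "AE x in \<mu>. x \<in> {(t, f t) | t. t \<in> {0..1} \<times> {0..1}}" using \<mu>(3) by (simp add: f_def)
      show "bdd_above (range (\<lambda>\<xi>. (cmod (fourier_transform \<mu> \<xi>))\<^sup>2 * norm \<xi> powr s))" if "0 \<le> s" "s < 2" for s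
        by (rule additive_graph_fourier_bounded[OF \<mu>(4) C1(1) C2(1) C1(2) C2(2) that])
    qed (rule fourier_exponent_graph_le_2[OF cf])
  qed
qed

end
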